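(* Let $G$ be a locally compact second countable group and let $X$ be a free Borel $G$-space. Then the orbit equivalence relation $E_G^X$ is sectional-hyperfinite if and only if it is hypercompact.
   Context: A locally compact second countable (lcsc) group is a Polish group whose topology is locally compact. A Borel $G$-space is a standard Borel space $X$ with a Borel map $G\times X\to X$, $(g,x)\mapsto g.x$, such that $e.x=x$ and $gh.x=g.(h.x)$ for all $g,h\in G$, $x\in X$. It is free if $g.x\neq x$ for all $g\in G\setminus\{e\}$ and $x\in X$. The orbit equivalence relation is $E_G^X=\{(x,g.x):x\in X,g\in G\}\subseteq X\times X$. An OER on $X$ is a Borel subset $E\subseteq X\times X$ with $E\subseteq E_G^X$ that is an equivalence relation. For an OER $E$ and $x\in X$ put $G_E(x)=\{g\in G:(x,g.x)\in E\}$. Sectional-hyperfiniteness: A cross section of $X$ is a Borel set $\mathfrak{C}\subseteq X$ whose intersection with every $G$-orbit is nonempty and countable. A countable Borel equivalence relation $F$ (all classes countable) is hyperfinite if $F=\bigcup_n F_n$ for an increasing sequence $F_1\subseteq F_2\subseteq\cdots$ of Borel equivalence relations all of whose classes are finite. $E_G^X$ is sectional-hyperfinite if for one (equivalently every) cross section $\mathfrak{C}$ of $X$, the relation $E_G^X\cap(\mathfrak{C}\times\mathfrak{C})$ is hyperfinite. Hypercompactness ($X$ free): An OER $E$ is compact if $G_E(x)$ is relatively compact in $G$ for every $x\in X$; it is uniformly compact if there is a compact $K\subset G$ with $G_E(x)\subseteq K$ for every $x\in X$. A compact filtration of $E_G^X$ is an increasing sequence $E_1\subseteq E_2\subseteq\cdots$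 of compact OERs with $E_G^X=\bigcup_n E_n$. It is equicompact if for every $x\in X$ and every compact $C\subset G$, $C\subseteq G_{E_n}(x)$ for all sufficiently large $n$. $E_G^X$ is hypercompact if it admits a compact filtration; equivalently, an equicompact filtration; equivalently, an equicompact filtration consisting of uniformly compact OERs. *)

theory Defs
  imports "HOL-Analysis.Analysis"
begin

text \<open>
  A group is a type of class \<^class>\<open>group_add\<close>, which does not assume commutativity; so the
  group law is written additively, with neutral element \<open>0\<close>, although \<open>G\<close> may be non-abelian.
  A Polish group is a type of sort \<open>{topological_group_add, polish_space}\<close>; the metric carried
  by \<^class>\<open>polish_space\<close> is an arbitrary complete metric inducing the topology and is used
  nowhere else.  Borel spaces are given by a \<^typ>\<open>'x measure\<close>, of which only
  \<^const>\<open>space\<close> and \<^const>\<open>sets\<close> matter.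
\<close>

definition standard_borel_space :: "'x measure \<Rightarrow> bool" where
  "standard_borel_space X \<longleftrightarrow>
     (\<exists>T. completely_metrizable_space T \<and> second_countable T \<and> topspace T = space X \<and>
          sets X = sigma_sets (topspace T) {U. openin T U})"

definition borel_G_space ::
  "'x measure \<Rightarrow> ('g::{topological_group_add, polish_space} \<Rightarrow> 'x \<Rightarrow> 'x) \<Rightarrow> bool" where
  "borel_G_space X act \<longleftrightarrow>
     standard_borel_space X \<and>
     (\<lambda>(g, x). act g x) \<in> borel \<Otimes>\<^sub>M X \<rightarrow>\<^sub>M X \<and>
     (\<forall>x\<in>space X. act 0 x = x) \<and>
     (\<forall>g h. \<forall>x\<in>space X. act (g + h) x = act g (act h x))"

definition free_action :: "'x measure \<Rightarrow> ('g::zero \<Rightarrow> 'x \<Rightarrow> 'x) \<Rightarrow> bool" where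
  "free_action X act \<longleftrightarrow> (\<forall>g. \<forall>x\<in>space X. g \<noteq> 0 \<longrightarrow> act g x \<noteq> x)"

definition orbit_rel :: "'x measure \<Rightarrow> ('g \<Rightarrow> 'x \<Rightarrow> 'x) \<Rightarrow> ('x \<times> 'x) set" where
  "orbit_rel X act = {(x, act g x) | x g. x \<in> space X}"

definition borel_equiv_rel :: "'x measure \<Rightarrow> ('x \<times> 'x) set \<Rightarrow> bool" where
  "borel_equiv_rel X F \<longleftrightarrow> F \<in> sets (X \<Otimes>\<^sub>M X) \<and> equiv (space X) F"

definition cross_section :: "'x measure \<Rightarrow> ('g \<Rightarrow> 'x \<Rightarrow> 'x) \<Rightarrow> 'x set \<Rightarrow> bool" where
  "cross_section X act C \<longleftrightarrow>
     C \<in> sets X \<and>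
     (\<forall>x\<in>space X. range (\<lambda>g. act g x) \<inter> C \<noteq> {} \<and> countable (range (\<lambda>g. act g x) \<inter> C))"

definition hyperfinite :: "'x measure \<Rightarrow> ('x \<times> 'x) set \<Rightarrow> bool" where
  "hyperfinite X F \<longleftrightarrow>
     borel_equiv_rel X F \<and> (\<forall>x\<in>space X. countable (F `` {x})) \<and>
     (\<exists>Fn :: nat \<Rightarrow> ('x \<times> 'x) set.
        incseq Fn \<and>
        (\<forall>n. borel_equiv_rel X (Fn n) \<and> (\<forall>x\<in>space X. finite (Fn n `` {x}))) \<and>
        F = (\<Union>n. Fn n))"

definition sectional_hyperfinite :: "'x measure \<Rightarrow> ('g \<Rightarrow> 'x \<Rightarrow> 'x) \<Rightarrow> bool" where
  "sectional_hyperfinite X act \<longleftrightarrow>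
     (\<exists>C. cross_section X act C \<and>
          hyperfinite (restrict_space X C) (orbit_rel X act \<inter> (C \<times> C)))"

definition OER :: "'x measure \<Rightarrow> ('g \<Rightarrow> 'x \<Rightarrow> 'x) \<Rightarrow> ('x \<times> 'x) set \<Rightarrow> bool" where
  "OER X act E \<longleftrightarrow> borel_equiv_rel X E \<and> E \<subseteq> orbit_rel X act"

definition return_set :: "('g \<Rightarrow> 'x \<Rightarrow> 'x) \<Rightarrow> ('x \<times> 'x) set \<Rightarrow> 'x \<Rightarrow> 'g set" where
  "return_set act E x = {g. (x, act g x) \<in> E}"

definition compact_OER ::
  "'x measure \<Rightarrow> ('g::topological_space \<Rightarrow> 'x \<Rightarrow> 'x) \<Rightarrow> ('x \<times> 'x) set \<Rightarrow> bool" where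
  "compact_OER X act E \<longleftrightarrow>
     OER X act E \<and> (\<forall>x\<in>space X. compact (closure (return_set act E x)))"

definition compact_filtration ::
  "'x measure \<Rightarrow> ('g::topological_space \<Rightarrow> 'x \<Rightarrow> 'x) \<Rightarrow> (nat \<Rightarrow> ('x \<times> 'x) set) \<Rightarrow> bool" where
  "compact_filtration X act E \<longleftrightarrow>
     incseq E \<and> (\<forall>n. compact_OER X act (E n)) \<and> orbit_rel X act = (\<Union>n. E n)"

definition hypercompact :: "'x measure \<Rightarrow> ('g::topological_space \<Rightarrow> 'x \<Rightarrow> 'x) \<Rightarrow> bool" where
  "hypercompact X act \<longleftrightarrow> (\<exists>E. compact_filtration X act E)"

end

theory Submission
  imports Defs
begin

text \<open>
  From hyperfinite to hypercompact: by the Lusin--Novikov theorem there is a Borel map \<open>\<rho> : X \<rightarrow> G\<close> with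
  \<open>\<rho>(x).x\<close> in the given cross section. If \<open>F\<^sub>n\<close> are finite Borel equivalence relations exhausting the
  orbit relation on the cross section and \<open>K\<^sub>n\<close> are compact sets exhausting \<open>G\<close>, let \<open>E\<^sub>n\<close> identify
  points \<open>x, y\<close> with \<open>\<rho>(x), \<rho>(y) \<in> K\<^sub>n\<close> whose images in the cross section are \<open>F\<^sub>n\<close>-equivalent.

  From hypercompact to hyperfinite: let \<open>E\<close> be a compact relation of the filtration and \<open>B\<close> a
  neighbourhood of the neutral element. The set \<open>S(x)\<close> of all \<open>h\<close> such that the \<open>E\<close>-class of \<open>x\<close> is
  comeager in \<open>Bh\<close> is compact, so a real injection of \<open>X\<close> that is lower semicontinuous along orbits,
  which is built from category quantifiers, has a unique minimum on \<open>S(x).x\<close>. It depends only on the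
  class, and the points selected in this way are \<open>B\<close>-separated on each orbit. By the Baire category
  theorem the selections for all \<open>E\<close> and countably many \<open>B\<close> form a cross section. It is an increasing
  union of Borel sets that meet the classes of compact relations in finite sets.
\<close>

section \<open>Analytic sets\<close>

text \<open>Minimizing directly over a class of a compact relation fails: along the orbit the class
  is Borel and relatively compact but not closed, so a minimum need not exist. The centres at which
  the class is comeager form a closed set that still depends only on the class. The price is that
  the chosen point may lie outside the class that chose it; it is tied to that class by category
  alone. The action is merely Borel, so ordinary coordinates on \<open>X\<close> need not be
  semicontinuous along orbits. Evaluating them at nonmeagerly many translates makes them so. A
  nonmeager Borel subset of \<open>G\<close> is comeager in some nonempty open set. Every point is
  therefore caught by some relation of the filtration and some neighbourhood of the neutral element,
  but which ones depends on the point, whence the countable family of selections. In the other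
  direction a return element has to be chosen in a Borel way. Freeness turns the countable trace of
  the cross section on an orbit into a countable set of group elements, so that the uniformization
  takes place in the Polish space \<open>G\<close>.\<close>

instantiation nat :: metric_space
begin

definition dist_nat :: "nat \<Rightarrow> nat \<Rightarrow> real" where
  "dist_nat m n = \<bar>real m - real n\<bar>"

definition uniformity_nat :: "(nat \<times> nat) filter" where
  "uniformity_nat = (INF e\<in>{0 <..}. principal {(x, y). dist x y < e})"

instance
proof
  show "open U \<longleftrightarrow> (\<forall>x\<in>U. \<forall>\<^sub>F (x', y) in uniformity. x' = x \<longrightarrow> y \<in> U)" for U :: "nat set"
  proof -
    have dist_nat_less_one: "x = y" if "\<bar>real x - real y\<bar> < 1" for x y :: nat
      using that by linarith
    have "\<forall>\<^sub>F (x', y) in uniformity. x' = x \<longrightarrow> y \<in> U" if "x \<in> U" for x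
    proof -
      have "\<forall>\<^sub>F p in uniformity. p \<in> {(x, y :: nat). dist x y < 1}"
        unfolding uniformity_nat_def by (rule eventually_INF1[of 1]) (auto simp: eventually_principal)
      then show ?thesis
        by eventually_elim (use that in \<open>auto simp: dist_nat_def dest!: dist_nat_less_one\<close>)
    qed
    then show ?thesis by (auto simp: open_discrete)
  qed
qed (auto simp: dist_nat_def uniformity_nat_def)

end

text \<open>This makes Baire space, the type \<open>nat \<Rightarrow> nat\<close> with the product
  topology, a Polish space, so that closed subsets of it are themselves analytic.\<close>

instance nat :: polish_space
proof
  fix X :: "nat \<Rightarrow> nat" assume "Cauchy X"
  then obtain M where "\<And>m. m \<ge> M \<Longrightarrow> dist (X m) (X M) < 1"
    by (metis less_numeral_extra(1) metric_CauchyD order_refl)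
  then have "\<And>m. m \<ge> M \<Longrightarrow> X m = X M"
    unfolding dist_nat_def by (smt (verit) of_nat_eq_iff of_nat_less_iff linorder_neqE_nat of_nat_1 Suc_leI of_nat_Suc of_nat_le_iff)
  then have "X \<longlonglongrightarrow> X M"
    by (intro tendsto_eventually) (unfold eventually_sequentially, blast)
  then show "convergent X" by (auto simp: convergent_def)
qed

instance prod :: (polish_space, polish_space) polish_space ..

definition analytic :: "'a::topological_space set \<Rightarrow> bool" where
  "analytic A \<longleftrightarrow> A = {} \<or> (\<exists>f :: (nat \<Rightarrow> nat) \<Rightarrow> 'a. continuous_on UNIV f \<and> range f = A)"

lemma analytic_image_continuous:
  assumes "analytic A" "continuous_on A f"
  shows "analytic (f ` A)"
proof (cases "A = {}")
  case False
  then obtain h :: "(nat \<Rightarrow> nat) \<Rightarrow> 'a" where h: "continuous_on UNIV h" "range h = A"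
    using assms(1) unfolding analytic_def by blast
  have "continuous_on UNIV (f \<circ> h)"
    using h assms(2) by (intro continuous_on_compose) auto
  moreover have "range (f \<circ> h) = f ` A"
    using h by auto
  ultimately show ?thesis
    unfolding analytic_def by blast
qed (simp add: analytic_def)

definition cylinder :: "(nat \<Rightarrow> nat) \<Rightarrow> nat \<Rightarrow> (nat \<Rightarrow> nat) set" where
  "cylinder \<alpha> n = {\<beta>. \<forall>i<n. \<beta> i = \<alpha> i}"

lemma open_cylinder: "open (cylinder \<alpha> n)"
proof -
  have "cylinder \<alpha> n = {\<beta>. \<forall>i\<in>{..<n}. \<beta> i \<in> {\<alpha> i}}"
    by (auto simp: cylinder_def)
  moreover have "open {\<beta>::nat\<Rightarrow>nat. \<forall>i\<in>{..<n}. \<beta> (id i) \<in> {\<alpha> i}}"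
    by (rule product_topology_basis'[of "{..<n}" "\<lambda>i. {\<alpha> i}" id]) (auto simp: open_discrete)
  ultimately show ?thesis by simp
qed

lemma cylinder_subset_open:
  assumes "open U" "\<alpha> \<in> U"
  obtains n where "cylinder \<alpha> n \<subseteq> U"
proof -
  have U: "openin (product_topology (\<lambda>i::nat. euclidean :: nat topology) UNIV) U"
    using assms(1) unfolding open_fun_def .
  obtain V where V: "\<alpha> \<in> Pi\<^sub>E UNIV V" "finite {i. V i \<noteq> UNIV}" "Pi\<^sub>E UNIV V \<subseteq> U"
    using product_topology_open_contains_basis[OF U assms(2)] by (metis topspace_euclidean)
  obtain n where n: "\<forall>i\<in>{i. V i \<noteq> UNIV}. i < n"
    using V(2) finite_nat_set_iff_bounded by metis
  have "cylinder \<alpha> n \<subseteq> Pi\<^sub>E UNIV V"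
  proof
    fix \<beta> assume b: "\<beta> \<in> cylinder \<alpha> n"
    have "\<beta> i \<in> V i" for i
      using b n V(1) unfolding cylinder_def by (cases "V i = UNIV") (auto simp: PiE_def Pi_def)
    then show "\<beta> \<in> Pi\<^sub>E UNIV V" by auto
  qed
  then show ?thesis using V(3) by (intro that[of n]) (rule subset_trans)
qed

lemma continuous_on_cylinder:
  fixes f :: "(nat \<Rightarrow> nat) \<Rightarrow> 'a::metric_space"
  assumes "\<And>\<alpha> e. e > 0 \<Longrightarrow> \<exists>n. \<forall>\<beta>\<in>cylinder \<alpha> n. dist (f \<beta>) (f \<alpha>) < e"
  shows "continuous_on UNIV f"
proof -
  have "(f \<longlongrightarrow> f \<alpha>) (at \<alpha>)" for \<alpha>
  proof (rule tendstoI)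
    fix e :: real assume "e > 0"
    then obtain n where n: "\<forall>\<beta>\<in>cylinder \<alpha> n. dist (f \<beta>) (f \<alpha>) < e"
      using assms by blast
    show "\<forall>\<^sub>F x in at \<alpha>. dist (f x) (f \<alpha>) < e"
      unfolding eventually_at_topological
      using n open_cylinder[of \<alpha> n] by (intro exI[of _ "cylinder \<alpha> n"]) (auto simp: cylinder_def)
  qed
  then show ?thesis by (simp add: continuous_on_def)
qed

text \<open>A sequence is read as a list of candidates from a dense subset; the candidate at index
  \<open>Suc n\<close> replaces the current point only if it is closer than \<open>(1/2)^n\<close>.
  Thus every sequence, without any pruning, yields a Cauchy sequence whose limit depends
  continuously on it.\<close>

lemma analytic_closed:
  fixes S :: "'a::polish_space set"
  assumes "closed S"
  shows "analytic S"
proof (cases "S = {}")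
  case False
  obtain T where T: "countable T" "T \<subseteq> S" "S \<subseteq> closure T"
    using separable by metis
  have Tne: "T \<noteq> {}" using T False by auto
  define q where "q = from_nat_into T"
  have qS: "q n \<in> S" for n
    using T Tne from_nat_into unfolding q_def by blast
  have dense: "\<exists>n. dist (q n) x < e" if "x \<in> S" "e > 0" for x and e::real
  proof -
    have "x \<in> closure T" using that T by blast
    then obtain y where y: "y \<in> T" "dist y x < e"
      using \<open>e > 0\<close> unfolding closure_approachable by blast
    then obtain n where "q n = y"
      unfolding q_def using T(1) from_nat_into_surj by metis
    then show ?thesis using y by blast
  qed
  define a where "a = (\<lambda>\<alpha>::nat\<Rightarrow>nat. rec_nat (q (\<alpha> 0))
      (\<lambda>n y. if dist (q (\<alpha> (Suc n))) y < (1/2)^n then q (\<alpha> (Suc n)) else y))"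
  have a0: "a \<alpha> 0 = q (\<alpha> 0)" for \<alpha> by (simp add: a_def)
  have aS: "a \<alpha> (Suc n) = (if dist (q (\<alpha> (Suc n))) (a \<alpha> n) < (1/2)^n then q (\<alpha> (Suc n)) else a \<alpha> n)" for \<alpha> n
    by (simp add: a_def)
  have ain: "a \<alpha> n \<in> S" for \<alpha> n
    by (induct n) (auto simp: a0 aS qS)
  have step: "dist (a \<alpha> (Suc n)) (a \<alpha> n) < (1/2)^n" for \<alpha> n
    by (simp add: aS)
  have tail: "dist (a \<alpha> (n + k)) (a \<alpha> n) \<le> 2 * (1/2)^n - 2 * (1/2)^(n+k)" for \<alpha> n k
  proof (induct k)
    case (Suc k)
    have "dist (a \<alpha> (n + Suc k)) (a \<alpha> n) \<le> dist (a \<alpha> (Suc (n + k))) (a \<alpha> (n+k)) + dist (a \<alpha> (n + k)) (a \<alpha> n)"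
      by (simp add: dist_triangle)
    also have "\<dots> \<le> (1/2)^(n+k) + (2 * (1/2)^n - 2 * (1/2)^(n+k))"
      using step[of \<alpha> "n+k"] Suc by linarith
    finally show ?case by simp
  qed simp
  have tail': "dist (a \<alpha> m) (a \<alpha> n) \<le> 2 * (1/2)^n" if "n \<le> m" for \<alpha> n m
  proof -
    have "(0::real) \<le> 2 * (1/2)^m" by simp
    then show ?thesis
      using tail[of \<alpha> n "m - n"] that by (smt (verit) le_add_diff_inverse)
  qed
  have "Cauchy (a \<alpha>)" for \<alpha>
  proof (rule metric_CauchyI)
    fix e :: real assume "e > 0"
    then have "\<exists>n. (1/2)^n < e/4"
      by (intro real_arch_pow_inv) simp_all
    then obtain n where n: "(1/2)^n < e/4" ..
    have "dist (a \<alpha> m) (a \<alpha> m') < e" if "m \<ge> n" "m' \<ge> n" for m m'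
    proof -
      have "dist (a \<alpha> m) (a \<alpha> m') \<le> dist (a \<alpha> m) (a \<alpha> n) + dist (a \<alpha> m') (a \<alpha> n)"
        by (rule dist_triangle2)
      also have "\<dots> \<le> 2 * (1/2)^n + 2 * (1/2)^n"
        using that by (intro add_mono tail')
      finally show ?thesis using n by linarith
    qed
    then show "\<exists>M. \<forall>m\<ge>M. \<forall>n\<ge>M. dist (a \<alpha> m) (a \<alpha> n) < e" by blast
  qed
  then have conv: "a \<alpha> \<longlonglongrightarrow> lim (a \<alpha>)" for \<alpha>
    using Cauchy_convergent_iff convergent_LIMSEQ_iff by blast
  define f where "f = (\<lambda>\<alpha>. lim (a \<alpha>))"
  have fS: "f \<alpha> \<in> S" for \<alpha>
    using conv ain assms unfolding f_def by (meson closed_sequentially)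
  have fd: "dist (f \<alpha>) (a \<alpha> n) \<le> 2 * (1/2)^n" for \<alpha> n
    unfolding f_def
    by (rule LIMSEQ_le_const2[OF tendsto_dist[OF conv tendsto_const]]) (use tail' in blast)
  have acyl: "a \<beta> n = a \<alpha> n" if "\<beta> \<in> cylinder \<alpha> (Suc n)" for \<alpha> \<beta> n
    using that by (induct n) (auto simp: a0 aS cylinder_def)
  have "continuous_on UNIV f"
  proof (rule continuous_on_cylinder)
    fix \<alpha> and e :: real assume "e > 0"
    then have "\<exists>n. (1/2)^n < e/4"
      by (intro real_arch_pow_inv) simp_all
    then obtain n where n: "(1/2)^n < e/4" ..
    have "dist (f \<beta>) (f \<alpha>) < e" if "\<beta> \<in> cylinder \<alpha> (Suc n)" for \<beta>
    proof -
      have "dist (f \<beta>) (f \<alpha>) \<le> dist (f \<beta>) (a \<alpha> n) + dist (f \<alpha>) (a \<alpha> n)"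
        by (rule dist_triangle2)
      also have "\<dots> \<le> 2 * (1/2)^n + 2 * (1/2)^n"
        using fd[of \<beta> n] fd[of \<alpha> n] acyl[OF that] by simp
      finally show ?thesis using n by linarith
    qed
    then show "\<exists>n. \<forall>\<beta>\<in>cylinder \<alpha> n. dist (f \<beta>) (f \<alpha>) < e" by blast
  qed
  moreover have "range f = S"
  proof
    show "range f \<subseteq> S" using fS by blast
    show "S \<subseteq> range f"
    proof
      fix x assume "x \<in> S"
      \<comment> \<open>The factor 1/4 leaves room: consecutive candidates are then closer than
        \<open>(1/2)^n\<close>, so all of them are accepted.\<close>
      then have "\<exists>j. dist (q j) x < (1/2)^n / 4" for n
        by (intro dense) auto
      then obtain \<alpha> where al: "\<And>n. dist (q (\<alpha> n)) x < (1/2)^n / 4" by metis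
      have an: "a \<alpha> n = q (\<alpha> n)" for n
      proof (induct n)
        case (Suc n)
        have "dist (q (\<alpha> (Suc n))) (q (\<alpha> n)) \<le> dist (q (\<alpha> (Suc n))) x + dist (q (\<alpha> n)) x"
          by (rule dist_triangle2)
        also have "\<dots> < (1/2)^Suc n / 4 + (1/2)^n / 4"
          using al by (intro add_strict_mono)
        also have "\<dots> \<le> (1/2)^n" by simp
        finally show ?case using Suc by (simp add: aS)
      qed (simp add: a0)
      have "(\<lambda>n. (1/2::real)^n / 4) \<longlonglongrightarrow> 0 / 4"
        by (intro tendsto_divide LIMSEQ_power_zero tendsto_const) auto
      have "(\<lambda>n. dist (q (\<alpha> n)) x) \<longlonglongrightarrow> 0"
      proof (rule Lim_null_comparison[rotated])
        show "(\<lambda>n. (1/2::real)^n / 4) \<longlonglongrightarrow> 0"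
          using \<open>(\<lambda>n. (1/2::real)^n / 4) \<longlonglongrightarrow> 0 / 4\<close> by (simp only: div_0)
        show "\<forall>\<^sub>F n in sequentially. norm (dist (q (\<alpha> n)) x) \<le> (1/2)^n / 4"
        proof (intro always_eventually allI)
          show "norm (dist (q (\<alpha> n)) x) \<le> (1/2)^n / 4" for n
            using al[of n] by (simp only: real_norm_def abs_of_nonneg[OF zero_le_dist] less_imp_le)
        qed
      qed
      then have "a \<alpha> \<longlonglongrightarrow> x"
        using an tendsto_dist_iff[of "a \<alpha>" x] by simp
      then have "f \<alpha> = x" using conv LIMSEQ_unique unfolding f_def by blast
      then show "x \<in> range f" by blast
    qed
  qed
  ultimately show ?thesis unfolding analytic_def by blast
qed (simp add: analytic_def)

lemma analytic_image_closed:
  fixes F :: "(nat \<Rightarrow> nat) set"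
  assumes "closed F" "continuous_on F f"
  shows "analytic (f ` F)"
  using analytic_image_continuous[OF analytic_closed[OF assms(1)] assms(2)] .

lemma continuous_on_comp_index: "continuous_on UNIV (\<lambda>\<alpha>::nat\<Rightarrow>nat. \<alpha> \<circ> h)"
proof (rule continuous_on_coordinatewise_then_product)
  show "continuous_on UNIV (\<lambda>\<alpha>::nat\<Rightarrow>nat. (\<alpha> \<circ> h) i)" for i
    unfolding o_def by (rule continuous_on_product_coordinates)
qed

text \<open>The first coordinate names a member of the family and the shifted sequence parametrizes
  it; continuity holds because the first coordinate is locally constant.\<close>

lemma analytic_UN:
  fixes A :: "nat \<Rightarrow> 'a::topological_space set"
  assumes "\<And>n. analytic (A n)"
  shows "analytic (\<Union>n. A n)"
proof (cases "\<forall>n. A n = {}")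
  case False
  then obtain m where m: "A m \<noteq> {}" by blast
  \<comment> \<open>Empty members are replaced by a nonempty one, so that each has a parametrization
    by all of Baire space.\<close>
  define B where "B n = (if A n = {} then A m else A n)" for n
  have UB: "(\<Union>n. B n) = (\<Union>n. A n)"
    unfolding B_def by (auto split: if_splits)
  have "\<exists>f :: (nat \<Rightarrow> nat) \<Rightarrow> 'a. continuous_on UNIV f \<and> range f = B n" for n
    using assms[of n] assms[of m] m unfolding analytic_def B_def by auto
  then obtain f :: "nat \<Rightarrow> (nat \<Rightarrow> nat) \<Rightarrow> 'a"
    where f: "\<And>n. continuous_on UNIV (f n)" "\<And>n. range (f n) = B n" by metis
  define h where "h \<alpha> = f (\<alpha> 0) (\<alpha> \<circ> Suc)" for \<alpha>
  have "continuous_on UNIV h"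
    unfolding continuous_on_open_vimage[OF open_UNIV]
  proof (intro allI impI)
    fix U :: "'a set" assume U: "open U"
    have "h -` U = (\<Union>n. {\<alpha>. \<alpha> 0 \<in> {n}} \<inter> (\<lambda>\<alpha>. f n (\<alpha> \<circ> Suc)) -` U)"
      unfolding h_def by auto
    moreover have "open ((\<lambda>\<alpha>. f n (\<alpha> \<circ> Suc)) -` U)" for n
      using continuous_on_compose2[OF f(1) continuous_on_comp_index[of Suc]] U
      by (simp add: continuous_on_open_vimage)
    moreover have "open {\<alpha>::nat\<Rightarrow>nat. \<alpha> 0 \<in> {n}}" for n
      using open_vimage[OF _ continuous_on_product_coordinates, of "{n}" "0::nat"]
      by (simp add: open_discrete vimage_def)
    ultimately show "open (h -` U \<inter> UNIV)" by (auto intro!: open_UN open_Int)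
  qed
  moreover have "range h = (\<Union>n. B n)"
  proof
    show "range h \<subseteq> (\<Union>n. B n)" using f(2) unfolding h_def by blast
    show "(\<Union>n. B n) \<subseteq> range h"
    proof
      fix x assume "x \<in> (\<Union>n. B n)"
      then obtain n \<alpha> where "x = f n \<alpha>" using f(2) by blast
      then have "x = h (case_nat n \<alpha>)" unfolding h_def by (simp add: o_def)
      then show "x \<in> range h" by blast
    qed
  qed
  ultimately show ?thesis using UB unfolding analytic_def by auto
qed (simp add: analytic_def)

text \<open>One sequence carries codes for points of all the sets, split by the pairing function. In
  a Hausdorff space the requirement that all decoded points agree is closed.\<close>

lemma analytic_INT:
  fixes A :: "nat \<Rightarrow> 'a::t2_space set"
  assumes "\<And>n. analytic (A n)"
  shows "analytic (\<Inter>n. A n)"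
proof (cases "\<exists>n. A n = {}")
  case True
  then have "(\<Inter>n. A n) = {}" by blast
  then show ?thesis by (simp add: analytic_def)
next
  case False
  then have "\<exists>f :: (nat \<Rightarrow> nat) \<Rightarrow> 'a. continuous_on UNIV f \<and> range f = A n" for n
    using assms[of n] unfolding analytic_def by auto
  then obtain f :: "nat \<Rightarrow> (nat \<Rightarrow> nat) \<Rightarrow> 'a"
    where f: "\<And>n. continuous_on UNIV (f n)" "\<And>n. range (f n) = A n" by metis
  define g where "g n \<alpha> = f n (\<alpha> \<circ> (\<lambda>k. prod_encode (n, k)))" for n \<alpha>
  have g: "continuous_on UNIV (g n)" for n
    unfolding g_def using continuous_on_compose2[OF f(1) continuous_on_comp_index] by blast
  define F where "F = (\<Inter>n. {\<alpha>. g n \<alpha> = g 0 \<alpha>})"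
  have "closed F"
    unfolding F_def by (intro closed_INT ballI closed_Collect_eq g)
  moreover have "g 0 ` F = (\<Inter>n. A n)"
  proof
    show "g 0 ` F \<subseteq> (\<Inter>n. A n)"
    proof clarify
      fix \<alpha> n assume "\<alpha> \<in> F"
      then have "g n \<alpha> = g 0 \<alpha>" unfolding F_def by blast
      then show "g 0 \<alpha> \<in> A n" using f(2)[of n] unfolding g_def by (metis rangeI)
    qed
    show "(\<Inter>n. A n) \<subseteq> g 0 ` F"
    proof
      fix x assume x: "x \<in> (\<Inter>n. A n)"
      then have "\<exists>\<alpha>. f n \<alpha> = x" for n using f(2) by (metis INT_iff UNIV_I image_iff)
      then obtain \<alpha> where al: "\<And>n. f n (\<alpha> n) = x" by metis
      define \<beta> where "\<beta> m = (case prod_decode m of (n, k) \<Rightarrow> \<alpha> n k)" for m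
      have "\<beta> \<circ> (\<lambda>k. prod_encode (n, k)) = \<alpha> n" for n
        unfolding \<beta>_def by auto
      then have "g n \<beta> = x" for n unfolding g_def by (simp add: al)
      then show "x \<in> g 0 ` F" unfolding F_def by force
    qed
  qed
  ultimately show ?thesis
    using analytic_image_closed[of F "g 0"] continuous_on_subset[OF g] by auto
qed

lemma analytic_Int:
  fixes A B :: "'a::t2_space set"
  assumes "analytic A" "analytic B"
  shows "analytic (A \<inter> B)"
proof -
  have "A \<inter> B = (\<Inter>n::nat. if n = 0 then A else B)" by (auto split: if_splits)
  moreover have "analytic (\<Inter>n::nat. if n = 0 then A else B)"
    by (rule analytic_INT) (use assms in auto)
  ultimately show ?thesis by simp
qed

text \<open>Complements of analytic sets are in general not analytic, so the induction treats a set
  and its complement together.\<close>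

lemma analytic_borel:
  fixes A :: "'a::polish_space set"
  assumes "A \<in> sets borel"
  shows "analytic A"
proof -
  have "A \<in> sigma_sets UNIV {S. closed S}"
    using assms unfolding borel_eq_closed by simp
  then have "analytic A \<and> analytic (- A)"
  proof induct
    case (Basic S)
    have "fsigma_in euclidean (- S)"
      using Basic open_imp_fsigma_in[OF metrizable_space_euclidean, of "- S"]
      by (simp add: open_Compl)
    then have "\<exists>F::nat \<Rightarrow> 'a set. (\<forall>n. closed (F n)) \<and> (\<forall>n. F n \<subseteq> F (Suc n)) \<and> \<Union> (range F) = - S"
      unfolding fsigma_in_ascending by (simp only: closed_closedin)
    then obtain F :: "nat \<Rightarrow> 'a set" where F: "\<forall>n. closed (F n)" "\<Union> (range F) = - S"
      by (elim exE conjE)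
    then show ?case
      using Basic F(1) analytic_closed analytic_UN[of F, unfolded F(2)] by blast
  next
    case Empty
    then show ?case by (auto simp: analytic_closed)
  next
    case (Compl S)
    then show ?case by (simp add: Compl_eq_Diff_UNIV double_diff)
  next
    case (Union S)
    have "- (\<Union>n. S n) = (\<Inter>n. - S n)" by blast
    then show ?case using Union analytic_UN[of S] analytic_INT[of "\<lambda>n. - S n"] by auto
  qed
  then show ?thesis ..
qed

section \<open>Separation and the theorems of Lusin, Souslin and Novikov\<close>

definition borel_separated :: "'a::topological_space set \<Rightarrow> 'a set \<Rightarrow> bool" where
  "borel_separated A B \<longleftrightarrow> (\<exists>Q\<in>sets borel. A \<subseteq> Q \<and> B \<inter> Q = {})"

text \<open>Applied in contrapositive form: if two countable unions are not separated, then neither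
  is some pair of their members.\<close>

lemma borel_separated_UN:
  assumes "\<And>m n. borel_separated (A m) (B n)"
  shows "borel_separated (\<Union>m::nat. A m) (\<Union>n::nat. B n)"
proof -
  obtain Q where Q: "\<And>m n. Q m n \<in> sets borel" "\<And>m n. A m \<subseteq> Q m n" "\<And>m n. B n \<inter> Q m n = {}"
    using assms unfolding borel_separated_def by metis
  show ?thesis
    unfolding borel_separated_def
  proof (intro bexI conjI)
    show "(\<Union>m. \<Inter>n. Q m n) \<in> sets borel"
      using Q(1) by (intro sets.countable_UN sets.countable_INT) auto
    show "(\<Union>m. A m) \<subseteq> (\<Union>m. \<Inter>n. Q m n)"
      using Q(2) by blast
    show "(\<Union>n. B n) \<inter> (\<Union>m. \<Inter>n. Q m n) = {}"
      using Q(3) by blast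
  qed
qed

section \<open>Cylinders given by finite sequences, and branches\<close>

definition list_cylinder :: "nat list \<Rightarrow> (nat \<Rightarrow> nat) set" where
  "list_cylinder s = {\<alpha>. \<forall>i<length s. \<alpha> i = s ! i}"

lemma list_cylinder_Nil [simp]: "list_cylinder [] = UNIV"
  by (simp add: list_cylinder_def)

lemma list_cylinder_eq_UN: "list_cylinder s = (\<Union>n. list_cylinder (s @ [n]))"
  by (auto simp: list_cylinder_def nth_append less_Suc_eq)

lemma list_cylinder_map: "list_cylinder (map \<alpha> [0..<n]) = cylinder \<alpha> n"
  by (auto simp: list_cylinder_def cylinder_def)

lemma take_map_list_cylinder:
  assumes "\<alpha> \<in> list_cylinder s" "length s \<le> n"
  shows "take (length s) (map \<alpha> [0..<n]) = s"
  using assms by (intro nth_equalityI) (auto simp: list_cylinder_def)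

lemma list_cylinder_take: "list_cylinder t \<subseteq> list_cylinder s" if "take (length s) t = s"
proof -
  have "length s \<le> length t" "\<And>i. i < length s \<Longrightarrow> s ! i = t ! i"
    using that by (metis length_take min.cobounded1) (metis that nth_take)
  then show ?thesis by (auto simp: list_cylinder_def)
qed

lemma list_cylinder_chain:
  fixes s :: "nat \<Rightarrow> nat list"
  assumes len: "\<And>n. length (s n) < length (s (Suc n))"
    and ext: "\<And>n. take (length (s n)) (s (Suc n)) = s n"
  obtains \<beta> where "\<And>n. \<beta> \<in> list_cylinder (s n)"
proof -
  have len': "n \<le> length (s n)" for n
    by (induct n) (use len Suc_le_eq order.strict_trans1 in blast)+
  have mono: "take (length (s n)) (s (n + k)) = s n" for n k
  proof (induct k)
    case (Suc k)
    have "length (s n) \<le> length (s (n + k))"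
      using Suc by (metis length_take min.cobounded1)
    then have "take (length (s n)) (s (n + Suc k)) = take (length (s n)) (take (length (s (n + k))) (s (Suc (n + k))))"
      by (simp add: min_absorb1)
    then show ?case using Suc ext by simp
  qed simp
  \<comment> \<open>Lengths grow at every step, so \<open>s (Suc m)\<close> does have an entry at
    index \<open>m\<close>.\<close>
  define \<beta> where "\<beta> m = s (Suc m) ! m" for m
  have "\<beta> m = s n ! m" if "m < length (s n)" for n m
  proof -
    have "s n ! m = s (n + Suc m) ! m"
      using mono[of n "Suc m"] that by (metis nth_take)
    moreover have "s (Suc m) ! m = s (Suc m + n) ! m"
      using mono[of "Suc m" n] len'[of "Suc m"] by (metis Suc_le_lessD nth_take)
    ultimately show ?thesis unfolding \<beta>_def by (simp add: add.commute)
  qed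
  then have "\<beta> \<in> list_cylinder (s n)" for n by (simp add: list_cylinder_def)
  then show ?thesis by (rule that)
qed

text \<open>Inseparability descends to ever smaller cylinders and so leads to two points of Baire
  space. Their images are distinct because the sets are disjoint, and by continuity disjoint open
  neighbourhoods of the images do separate small cylinders.\<close>

theorem analytic_separation:
  fixes A B :: "'a::t2_space set"
  assumes "analytic A" "analytic B" "A \<inter> B = {}"
  shows "borel_separated A B"
proof (rule ccontr)
  assume nsep: "\<not> borel_separated A B"
  have "A \<noteq> {}" "B \<noteq> {}"
    using nsep sets.empty_sets[of borel] sets.top[of borel] unfolding borel_separated_def by auto
  then obtain f g :: "(nat \<Rightarrow> nat) \<Rightarrow> 'a"
    where f: "continuous_on UNIV f" "range f = A" and g: "continuous_on UNIV g" "range g = B"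
    using assms(1,2) unfolding analytic_def by auto
  define P where "P n st \<longleftrightarrow> (case st of (s, t) \<Rightarrow> length s = n \<and> length t = n \<and>
      \<not> borel_separated (f ` list_cylinder s) (g ` list_cylinder t))" for n st
  have "\<exists>x. P 0 x"
    using nsep f g unfolding P_def by auto
  moreover have "\<exists>y. P (Suc n) y \<and> (\<exists>i j. y = (fst x @ [i], snd x @ [j]))" if "P n x" for x n
  proof -
    obtain s t where x: "x = (s, t)" by fastforce
    have fs: "f ` list_cylinder s = (\<Union>n. f ` list_cylinder (s @ [n]))"
      by (subst list_cylinder_eq_UN) blast
    have gt: "g ` list_cylinder t = (\<Union>n. g ` list_cylinder (t @ [n]))"
      by (subst list_cylinder_eq_UN) blast
    have "\<not> borel_separated (\<Union>n. f ` list_cylinder (s @ [n])) (\<Union>n. g ` list_cylinder (t @ [n]))"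
      using that x fs gt unfolding P_def by simp
    then obtain i j where "\<not> borel_separated (f ` list_cylinder (s @ [i])) (g ` list_cylinder (t @ [j]))"
      using borel_separated_UN by meson
    then show ?thesis
      using that x unfolding P_def by force
  qed
  ultimately obtain x where x: "\<And>n. P n (x n)" "\<And>n. \<exists>i j. x (Suc n) = (fst (x n) @ [i], snd (x n) @ [j])"
    using dependent_nat_choice[of P "\<lambda>n x y. \<exists>i j. y = (fst x @ [i], snd x @ [j])"] by blast
  define \<alpha> where "\<alpha> n = fst (x (Suc n)) ! n" for n
  define \<beta> where "\<beta> n = snd (x (Suc n)) ! n" for n
  have len: "length (fst (x n)) = n" "length (snd (x n)) = n" for n
    using x(1)[of n] unfolding P_def by (auto split: prod.splits)
  have "fst (x n) = map \<alpha> [0..<n] \<and> snd (x n) = map \<beta> [0..<n]" for n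
  proof (induct n)
    case 0
    show ?case using len[of 0] by simp
  next
    case (Suc n)
    obtain i j where ij: "x (Suc n) = (fst (x n) @ [i], snd (x n) @ [j])"
      using x(2) by blast
    have "\<alpha> n = i" "\<beta> n = j"
      unfolding \<alpha>_def \<beta>_def ij using len[of n] by (simp_all add: nth_append)
    then show ?case using ij Suc by simp
  qed
  then have ns: "\<not> borel_separated (f ` cylinder \<alpha> n) (g ` cylinder \<beta> n)" for n
    using x(1)[of n] unfolding P_def list_cylinder_map[symmetric] by (simp add: case_prod_unfold)
  have "f \<alpha> \<noteq> g \<beta>" using assms(3) f g by blast
  then obtain U V where UV: "open U" "open V" "f \<alpha> \<in> U" "g \<beta> \<in> V" "U \<inter> V = {}"
    using hausdorff by metis
  obtain m where m: "cylinder \<alpha> m \<subseteq> f -` U"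
    using cylinder_subset_open[of "f -` U" \<alpha>] UV f(1) by (auto simp: continuous_on_open_vimage)
  obtain n where n: "cylinder \<beta> n \<subseteq> g -` V"
    using cylinder_subset_open[of "g -` V" \<beta>] UV g(1) by (auto simp: continuous_on_open_vimage)
  have "cylinder \<alpha> (max m n) \<subseteq> cylinder \<alpha> m" "cylinder \<beta> (max m n) \<subseteq> cylinder \<beta> n"
    by (auto simp: cylinder_def)
  then have "f ` cylinder \<alpha> (max m n) \<subseteq> U" "g ` cylinder \<beta> (max m n) \<inter> U = {}"
    using m n UV(5) by blast+
  then have "borel_separated (f ` cylinder \<alpha> (max m n)) (g ` cylinder \<beta> (max m n))"
    using UV(1) unfolding borel_separated_def by (intro bexI[of _ U]) auto
  then show False using ns by blast
qed

text \<open>The point \<open>z \<in> D\<close> over \<open>y = p z\<close> is recovered as a limit of the centres of balls \<open>b\<close> such that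
  \<open>y\<close> lies in a Borel set separating \<open>p ` (D \<inter> b)\<close> from \<open>p ` (D - b)\<close>.\<close>

theorem lusin_souslin:
  fixes p :: "'a::polish_space \<Rightarrow> 'b::t2_space"
  assumes D: "D \<in> sets borel" and p: "continuous_on UNIV p" and inj: "inj_on p D"
  obtains r where "r \<in> borel_measurable borel" "\<And>z. z \<in> D \<Longrightarrow> r (p z) = z"
proof -
  obtain T :: "'a set" where T: "countable T" "closure T = UNIV"
    using separable[of "UNIV :: 'a set"] by (metis top.extremum_uniqueI)
  have Tne: "T \<noteq> {}" using T(2) by force
  define q where "q = from_nat_into T"
  have dense: "\<exists>n. dist (q n) x < e" if "e > 0" for x and e::real
  proof -
    have "x \<in> closure T" using T by simp
    then obtain y where y: "y \<in> T" "dist y x < e"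
      using \<open>e > 0\<close> unfolding closure_approachable by blast
    then obtain n where "q n = y"
      unfolding q_def using T(1) from_nat_into_surj by metis
    then show ?thesis using y by blast
  qed
  have "\<exists>Q\<in>sets borel. p ` (D \<inter> ball (q j) ((1/2)^k)) \<subseteq> Q \<and> p ` (D - ball (q j) ((1/2)^k)) \<inter> Q = {}" for j k
  proof -
    let ?b = "ball (q j) ((1/2)^k)"
    have "analytic (p ` (D \<inter> ?b))" "analytic (p ` (D - ?b))"
      using D by (auto intro!: analytic_image_continuous analytic_borel continuous_on_subset[OF p])
    moreover have "p ` (D \<inter> ?b) \<inter> p ` (D - ?b) = {}"
      using inj unfolding inj_on_def by blast
    ultimately show ?thesis
      using analytic_separation unfolding borel_separated_def by blast
  qed
  then obtain Q where Q: "\<And>j k. Q j k \<in> sets borel"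
      "\<And>j k. p ` (D \<inter> ball (q j) ((1/2)^k)) \<subseteq> Q j k"
      "\<And>j k. p ` (D - ball (q j) ((1/2)^k)) \<inter> Q j k = {}"
    by metis
  have QD: "p z \<in> Q j k \<longleftrightarrow> dist (q j) z < (1/2)^k" if "z \<in> D" for z j k
  proof (cases "z \<in> ball (q j) ((1/2)^k)")
    case True
    then show ?thesis using Q(2)[of j k] that by auto
  next
    case False
    then have "p z \<in> p ` (D - ball (q j) ((1/2)^k))" using that by blast
    then show ?thesis using Q(3)[of j k] False by auto
  qed
  \<comment> \<open>For \<open>y = p z\<close> with \<open>z \<in> D\<close>, membership in
    \<open>Q j k\<close> means that \<open>z\<close> is in the ball, so the centre found is within
    \<open>(1/2)^k\<close> of \<open>z\<close>.\<close>
  define s where "s k y = q (LEAST j. y \<in> Q j k)" for k y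
  have [measurable]: "Measurable.pred borel (\<lambda>y. y \<in> Q j k)" for j k
    using Q(1) by simp
  have s[measurable]: "s k \<in> borel_measurable borel" for k
    unfolding s_def by (rule measurable_compose[of _ _ "count_space UNIV"]) measurable
  \<comment> \<open>Off the image of \<open>D\<close> the centres need not converge. The constant
    default makes the limit exist everywhere, so that it is a Borel map.\<close>
  define t where "t k y = (if Cauchy (\<lambda>k. s k y) then s k y else q 0)" for k y
  have t: "t k \<in> borel_measurable borel" for k
    unfolding t_def by measurable
  define r where "r y = lim (\<lambda>k. t k y)" for y
  have conv: "(\<lambda>k. t k y) \<longlonglongrightarrow> r y" for y
  proof -
    have "Cauchy (\<lambda>k. t k y)"
      unfolding t_def
      using LIMSEQ_imp_Cauchy[OF tendsto_const, of "q 0"] by (cases "Cauchy (\<lambda>k. s k y)") simp_all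
    then show ?thesis
      unfolding r_def by (simp add: Cauchy_convergent_iff convergent_LIMSEQ_iff)
  qed
  have "r \<in> borel_measurable borel"
    by (rule borel_measurable_LIMSEQ_metric[OF t]) (rule conv)
  moreover have "r (p z) = z" if "z \<in> D" for z
  proof -
    have "dist (s k (p z)) z < (1/2)^k" for k
    proof -
      have "\<exists>j. p z \<in> Q j k" using QD[OF that] dense[of "(1/2)^k" z] by auto
      then have "p z \<in> Q (LEAST j. p z \<in> Q j k) k" by (rule LeastI_ex)
      then show ?thesis using QD[OF that] unfolding s_def by blast
    qed
    then have "(\<lambda>k. dist (s k (p z)) z) \<longlonglongrightarrow> 0"
      by (intro Lim_null_comparison[OF _ LIMSEQ_power_zero[of "1/2::real"]])
         (auto intro!: always_eventually less_imp_le)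
    then have sz: "(\<lambda>k. s k (p z)) \<longlonglongrightarrow> z"
      by (simp add: tendsto_dist_iff[symmetric])
    then have "Cauchy (\<lambda>k. s k (p z))" by (rule LIMSEQ_imp_Cauchy)
    then have "(\<lambda>k. t k (p z)) = (\<lambda>k. s k (p z))" unfolding t_def by simp
    then show ?thesis using conv[of "p z"] sz LIMSEQ_unique by metis
  qed
  ultimately show ?thesis by (rule that)
qed

text \<open>For disjoint basic open sets \<open>U, V\<close>, a Borel set separating \<open>p ` (D \<inter> U)\<close> from \<open>p ` (D \<inter> V)\<close>
  prevents points of \<open>U\<close> and \<open>V\<close> in the hull from having the same image.\<close>

lemma injective_borel_hull:
  fixes p :: "'a::{t2_space, second_countable_topology} \<Rightarrow> 'b::t2_space"
  assumes D: "analytic D" and p: "continuous_on UNIV p" and inj: "inj_on p D"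
    and an: "\<And>U :: 'a set. open U \<Longrightarrow> analytic U"
  obtains Q where "Q \<in> sets borel" "D \<subseteq> Q" "inj_on p Q"
proof -
  obtain \<B> :: "'a set set" where \<B>: "countable \<B>" "topological_basis \<B>"
    using ex_countable_basis by blast
  define I where "I = {(U, V). U \<in> \<B> \<and> V \<in> \<B> \<and> U \<inter> V = {}}"
  have "I \<subseteq> \<B> \<times> \<B>" unfolding I_def by blast
  then have I: "countable I" using \<B>(1) by (meson countable_SIGMA countable_subset)
  have "borel_separated (p ` (D \<inter> U)) (p ` (D \<inter> V))" if "(U, V) \<in> I" for U V
  proof (rule analytic_separation)
    have "open U" "open V" using that \<B>(2) topological_basis_open unfolding I_def by auto
    then show "analytic (p ` (D \<inter> U))" "analytic (p ` (D \<inter> V))"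
      using D an by (auto intro!: analytic_image_continuous analytic_Int continuous_on_subset[OF p])
    show "p ` (D \<inter> U) \<inter> p ` (D \<inter> V) = {}"
      using inj that unfolding inj_on_def I_def by blast
  qed
  then have "\<forall>UV\<in>I. \<exists>Q. Q \<in> sets borel \<and> p ` (D \<inter> fst UV) \<subseteq> Q \<and> p ` (D \<inter> snd UV) \<inter> Q = {}"
    unfolding borel_separated_def by fastforce
  then obtain Q where Q: "\<And>UV. UV \<in> I \<Longrightarrow> Q UV \<in> sets borel"
      "\<And>U V. (U, V) \<in> I \<Longrightarrow> p ` (D \<inter> U) \<subseteq> Q (U, V)"
      "\<And>U V. (U, V) \<in> I \<Longrightarrow> p ` (D \<inter> V) \<inter> Q (U, V) = {}"
    by (metis fst_conv snd_conv)
  \<comment> \<open>In \<open>H\<close>, points of \<open>U\<close> have image in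
    \<open>Q (U, V)\<close> and points of \<open>V\<close> have image outside it; points of
    \<open>D\<close> meet this requirement by the choice of \<open>Q\<close>.\<close>
  define H where "H = (\<Inter>UV\<in>I. - (fst UV - p -` Q UV) \<inter> - (snd UV \<inter> p -` Q UV))"
  have pm: "p \<in> borel_measurable borel" using p by (rule borel_measurable_continuous_onI)
  show ?thesis
  proof (rule that)
    show "H \<in> sets borel"
    proof (cases "I = {}")
      case False
      show ?thesis
        unfolding H_def
      proof (rule sets.countable_INT'[OF I False], safe)
        fix U V assume UV: "(U, V) \<in> I"
        then have "open U" "open V" using \<B>(2) topological_basis_open unfolding I_def by auto
        moreover have "p -` Q (U, V) \<in> sets borel"
          using measurable_sets[OF pm Q(1)[OF UV]] by simp
        ultimately show "- (fst (U, V) - p -` Q (U, V)) \<inter> - (snd (U, V) \<inter> p -` Q (U, V)) \<in> sets borel"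
          by (intro sets.Int borel_comp sets.Diff) auto
      qed
    qed (simp add: H_def)
    show "D \<subseteq> H"
      unfolding H_def using Q(2,3) by fastforce
    show "inj_on p H"
    proof (rule inj_onI, rule ccontr)
      fix x y assume xy: "x \<in> H" "y \<in> H" "p x = p y" "x \<noteq> y"
      obtain U V where UV: "open U" "open V" "x \<in> U" "y \<in> V" "U \<inter> V = {}"
        using hausdorff[OF xy(4)] by metis
      obtain U' where U': "U' \<in> \<B>" "x \<in> U'" "U' \<subseteq> U"
        using topological_basisE[OF \<B>(2) UV(1,3)] by metis
      obtain V' where V': "V' \<in> \<B>" "y \<in> V'" "V' \<subseteq> V"
        using topological_basisE[OF \<B>(2) UV(2,4)] by metis
      have "(U', V') \<in> I" using U' V' UV unfolding I_def by blast
      then show False using xy U' V' unfolding H_def by fastforce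
    qed
  qed
qed

text \<open>Otherwise a fibre of \<open>p\<close> is approximated by points \<open>\<beta>\<^sub>0, \<beta>\<^sub>1, \<dots>\<close> of Baire space, each of them a limit of
  later ones that have a different image under the parametrization \<open>f\<close> of \<open>P\<close>. The closure of these
  points is mapped into a countable fibre, so by the Baire category theorem \<open>f\<close> is constant on a
  nonempty relatively open part of it, a contradiction.\<close>

lemma lusin_novikov_cover:
  fixes p :: "'a::polish_space \<Rightarrow> 'b::t2_space"
  assumes P: "P \<in> sets borel" and p: "continuous_on UNIV p"
    and count: "\<And>y. countable (P \<inter> p -` {y})"
  obtains Q :: "nat \<Rightarrow> 'a set" where "\<And>n. Q n \<in> sets borel" "\<And>n. inj_on p (Q n)" "P \<subseteq> (\<Union>n. Q n)"
proof -
  define small where "small D \<longleftrightarrow> (\<exists>Q :: nat \<Rightarrow> 'a set. (\<forall>n. Q n \<in> sets borel \<and> inj_on p (Q n)) \<and> D \<subseteq> (\<Union>n. Q n))" for D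
  have small_UN: "small (\<Union>n::nat. D n)" if sD: "\<And>n. small (D n)" for D
  proof -
    have "\<forall>n. \<exists>Q :: nat \<Rightarrow> 'a set. (\<forall>m. Q m \<in> sets borel \<and> inj_on p (Q m)) \<and> D n \<subseteq> \<Union> (range Q)"
      using sD unfolding small_def by (rule allI)
    from choice[OF this] obtain Q :: "nat \<Rightarrow> nat \<Rightarrow> 'a set"
      where Q': "\<forall>n. (\<forall>m. Q n m \<in> sets borel \<and> inj_on p (Q n m)) \<and> D n \<subseteq> \<Union> (range (Q n))" ..
    then have Q: "\<And>n m. Q n m \<in> sets borel" "\<And>n m. inj_on p (Q n m)" "\<And>n. D n \<subseteq> (\<Union>m. Q n m)"
      by simp_all
    show ?thesis
      unfolding small_def
    proof (intro exI[of _ "\<lambda>k. case prod_decode k of (n, m) \<Rightarrow> Q n m"] conjI allI)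
      show "(case prod_decode k of (n, m) \<Rightarrow> Q n m) \<in> sets borel"
        "inj_on p (case prod_decode k of (n, m) \<Rightarrow> Q n m)" for k
        using Q by (auto split: prod.splits)
      show "(\<Union>n. D n) \<subseteq> (\<Union>k. case prod_decode k of (n, m) \<Rightarrow> Q n m)"
      proof
        fix x assume "x \<in> (\<Union>n. D n)"
        then obtain n m where "x \<in> Q n m" using Q(3) by blast
        then have "x \<in> (case prod_decode (prod_encode (n, m)) of (n, m) \<Rightarrow> Q n m)" by simp
        then show "x \<in> (\<Union>k. case prod_decode k of (n, m) \<Rightarrow> Q n m)" by (rule UN_I[OF UNIV_I])
      qed
    qed
  qed
  have small_subset: "small D" if "small D'" "D \<subseteq> D'" for D D'
  proof -
    obtain Q :: "nat \<Rightarrow> 'a set" where "\<forall>n. Q n \<in> sets borel \<and> inj_on p (Q n)" "D' \<subseteq> \<Union> (range Q)"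
      using \<open>small D'\<close> unfolding small_def by (elim exE conjE)
    then show ?thesis
      using \<open>D \<subseteq> D'\<close> unfolding small_def by (intro exI[of _ Q] conjI) (assumption, rule subset_trans)
  qed
  have small_inj: "small D" if "D \<subseteq> Q" "Q \<in> sets borel" "inj_on p Q" for D Q
    using that unfolding small_def by (intro exI[of _ "\<lambda>_. Q"]) auto
  have "small P"
  proof (rule ccontr)
    assume nsmall: "\<not> small P"
    then have "P \<noteq> {}" using small_inj[of "{}" "{}"] by auto
    then obtain f :: "(nat \<Rightarrow> nat) \<Rightarrow> 'a" where f: "continuous_on UNIV f" "range f = P"
      using analytic_borel[OF P] unfolding analytic_def by blast
    \<comment> \<open>An approximation is a list of finite sequences; a configuration for it in \<open>Y\<close> is a choice of
      points in the corresponding cylinders which \<open>f\<close> sends into a single fibre of \<open>p\<close> on \<open>Y\<close>.\<close>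
    define conf where "conf Y us z \<longleftrightarrow> (\<forall>i<length us. z i \<in> list_cylinder (us ! i) \<and> f (z i) \<in> Y \<and>
        p (f (z i)) = p (f (z 0)))" for Y us and z :: "nat \<Rightarrow> nat \<Rightarrow> nat"
    have conf: "z i \<in> list_cylinder (us ! i)" "f (z i) \<in> Y'" "p (f (z i)) = p (f (z 0))"
      if "conf Y' us z" "i < length us" for Y' us z i
      using that unfolding conf_def by blast+
    \<comment> \<open>Such an approximation is negligible: it loses all its configurations once a
      small part of \<open>P\<close> is discarded.\<close>
    define kills where "kills us Y \<longleftrightarrow> Y \<in> sets borel \<and> small (P - Y) \<and> (\<nexists>z. conf Y us z)" for us Y
    define K where "K us = (if \<exists>Y. kills us Y then SOME Y. kills us Y else UNIV)" for us
    have K3: "kills us (K us)" if "\<exists>Y. kills us Y" for us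
      unfolding K_def using someI_ex[OF that] that by simp
    have K: "K us \<in> sets borel" "small (P - K us)" for us
      using K3[of us] small_inj[of "{}" "{}"] unfolding kills_def K_def by (auto split: if_splits)
    \<comment> \<open>Lists of finite sequences are countable in number, so everything that can be
      killed is killed at once, at the cost of a small set. An approximation that still has a
      configuration in \<open>Y\<close> cannot be killed by any Borel set.\<close>
    define Y where "Y = (\<Inter>n. K (from_nat n))"
    have Yb: "Y \<in> sets borel"
      unfolding Y_def using K(1) by (intro sets.countable_INT) auto
    have "P - Y = (\<Union>n. P - K (from_nat n))" unfolding Y_def by blast
    then have Ys: "small (P - Y)" using small_UN[of "\<lambda>n. P - K (from_nat n)"] K(2) by simp
    have YK: "Y \<subseteq> K us" for us
      unfolding Y_def by (metis INT_lower UNIV_I from_nat_to_nat)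
    have notkilled: "\<not> kills us Y'" if "conf Y us z" for us z Y'
    proof
      assume "kills us Y'"
      then have "kills us (K us)" using K3 by blast
      moreover have "conf (K us) us z" using that YK[of us] unfolding conf_def by blast
      ultimately show False unfolding kills_def by blast
    qed
    \<comment> \<open>Otherwise \<open>p\<close> is injective on the set \<open>D\<close> of points
      that occur at position \<open>i\<close>. A Borel hull \<open>Q\<close> of \<open>D\<close> on
      which \<open>p\<close> is injective is small, and removing it from \<open>Y\<close> kills
      \<open>us\<close>.\<close>
    have split: "\<exists>z z'. conf Y us z \<and> conf Y us z' \<and> p (f (z i)) = p (f (z' i)) \<and> f (z i) \<noteq> f (z' i)"
      if ex: "conf Y us z0" and i: "i < length us" for us z0 i
    proof (rule ccontr)
      assume neg: "\<not> ?thesis"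
      define D where "D = {f (z i) | z. conf Y us z}"
      \<comment> \<open>A whole configuration is packed into one sequence, which exhibits
        \<open>D\<close> as a continuous image of a Borel subset of Baire space.\<close>
      define h where "h j \<gamma> = \<gamma> \<circ> (\<lambda>k. prod_encode (j, k))" for j :: nat and \<gamma> :: "nat \<Rightarrow> nat"
      have h: "continuous_on UNIV (h j)" for j
        unfolding h_def by (rule continuous_on_comp_index)
      have fh: "continuous_on UNIV (\<lambda>\<gamma>. f (h j \<gamma>))" for j
        by (rule continuous_on_compose2[OF f(1) h]) simp
      have pfh: "continuous_on UNIV (\<lambda>\<gamma>. p (f (h j \<gamma>)))" for j
        by (rule continuous_on_compose2[OF p fh]) simp
      define C where "C = {\<gamma>. conf Y us (\<lambda>j. h j \<gamma>)}"
      have "C = (\<Inter>j\<in>{..<length us}. h j -` list_cylinder (us ! j) \<inter> (\<lambda>\<gamma>. f (h j \<gamma>)) -` Y \<inter>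
          {\<gamma>. p (f (h j \<gamma>)) = p (f (h 0 \<gamma>))})"
        unfolding C_def conf_def by auto
      also have "\<dots> \<in> sets borel"
      proof (intro sets.finite_INT sets.Int)
        fix j assume "j \<in> {..<length us}"
        have "list_cylinder s \<in> sets borel" for s
          using list_cylinder_map[of "\<lambda>i. s ! i" "length s"] open_cylinder by (simp add: map_nth)
        then show "h j -` list_cylinder (us ! j) \<in> sets borel"
          using measurable_sets[OF borel_measurable_continuous_onI[OF h]] by simp
        show "(\<lambda>\<gamma>. f (h j \<gamma>)) -` Y \<in> sets borel"
          using measurable_sets[OF borel_measurable_continuous_onI[OF fh] Yb] by simp
        show "{\<gamma>. p (f (h j \<gamma>)) = p (f (h 0 \<gamma>))} \<in> sets borel"
          by (rule borel_closed[OF closed_Collect_eq[OF pfh pfh]])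
      qed (use i in auto)
      finally have "analytic C" by (rule analytic_borel)
      moreover have "D = (\<lambda>\<gamma>. f (h i \<gamma>)) ` C"
      proof
        show "(\<lambda>\<gamma>. f (h i \<gamma>)) ` C \<subseteq> D" unfolding D_def C_def by fast
        show "D \<subseteq> (\<lambda>\<gamma>. f (h i \<gamma>)) ` C"
        proof
          fix x assume "x \<in> D"
          then obtain z where z: "conf Y us z" "x = f (z i)" unfolding D_def by blast
          define \<gamma> where "\<gamma> m = (case prod_decode m of (j, k) \<Rightarrow> z j k)" for m
          have "h j \<gamma> = z j" for j unfolding h_def \<gamma>_def by auto
          then have "\<gamma> \<in> C" "x = f (h i \<gamma>)" using z unfolding C_def by simp_all
          then show "x \<in> (\<lambda>\<gamma>. f (h i \<gamma>)) ` C" by blast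
        qed
      qed
      ultimately have "analytic D"
        using analytic_image_continuous continuous_on_subset[OF fh subset_UNIV] by metis
      moreover have "inj_on p D"
        using neg unfolding D_def inj_on_def by blast
      ultimately obtain Q where Q: "Q \<in> sets borel" "D \<subseteq> Q" "inj_on p Q"
        using injective_borel_hull[OF _ p] analytic_borel borel_open by metis
      have "kills us (Y - Q)"
        unfolding kills_def
      proof (intro conjI notI)
        show "Y - Q \<in> sets borel" using Yb Q(1) by blast
        have "small ((P - Y) \<union> Q)"
        proof -
          have "(P - Y) \<union> Q = (\<Union>n::nat. if n = 0 then P - Y else Q)" by (auto split: if_splits)
          then show ?thesis
            using small_UN[of "\<lambda>n. if n = 0 then P - Y else Q"] Ys small_inj[OF order_refl Q(1,3)] by simp
        qed
        then show "small (P - (Y - Q))" by (rule small_subset) blast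
        assume "\<exists>z. conf (Y - Q) us z"
        then obtain z where z: "conf (Y - Q) us z" ..
        then have "conf Y us z" unfolding conf_def by blast
        then have "f (z i) \<in> Q" using Q(2) unfolding D_def by blast
        then show False using z i unfolding conf_def by blast
      qed
      then show False using notkilled[OF ex] by blast
    qed
    \<comment> \<open>Step \<open>n\<close> adds a new point close to the one with index
      \<open>target n\<close>. Every index is a target infinitely often, and
      \<open>target n \<le> n\<close> ensures that the old point is already present.\<close>
    define target where "target n = fst (prod_decode n)" for n
    have target_le: "target n \<le> n" for n
      unfolding target_def by (metis le_prod_encode_1 prod.collapse prod_decode_inverse)
    define good where "good n us \<longleftrightarrow> length us = Suc n \<and> (\<exists>z. conf Y us z)" for n us
    define extends where "extends n us vs \<longleftrightarrow> (\<forall>j\<le>n. length (vs ! j) > length (us ! j) \<and> take (length (us ! j)) (vs ! j) = us ! j) \<and>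
        take (length (us ! target n)) (vs ! Suc n) = us ! target n \<and>
        f ` list_cylinder (vs ! target n) \<inter> f ` list_cylinder (vs ! Suc n) = {}" for n us vs
    have step: "\<exists>vs. good (Suc n) vs \<and> extends n us vs" if g: "good n us" for n us
    proof -
      have len: "length us = Suc n" using g unfolding good_def by blast
      define i where "i = target n"
      have i: "i \<le> n" unfolding i_def by (rule target_le)
      obtain z z' where z: "conf Y us z" "conf Y us z'" "p (f (z i)) = p (f (z' i))" "f (z i) \<noteq> f (z' i)"
        using g split[of us _ i] i unfolding good_def by (metis le_imp_less_Suc)
      obtain U V where UV: "open U" "open V" "f (z i) \<in> U" "f (z' i) \<in> V" "U \<inter> V = {}"
        using hausdorff[OF z(4)] by metis
      obtain M where M: "cylinder (z i) M \<subseteq> f -` U"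
        using cylinder_subset_open[of "f -` U" "z i"] UV f(1) by (auto simp: continuous_on_open_vimage)
      obtain M' where M': "cylinder (z' i) M' \<subseteq> f -` V"
        using cylinder_subset_open[of "f -` V" "z' i"] UV f(1) by (auto simp: continuous_on_open_vimage)
      \<comment> \<open>The new length exceeds all the old ones and suffices for the two split
        cylinders to be mapped into \<open>U\<close> and \<open>V\<close>.\<close>
      define N where "N = Suc (M + M' + sum_list (map length us))"
      have lenN: "length (us ! j) < N" if "j \<le> n" for j
      proof -
        have "length (us ! j) \<in> set (map length us)" using that len by (simp add: le_imp_less_Suc)
        then have "length (us ! j) \<le> sum_list (map length us)" by (intro member_le_sum_list) simp_all
        then show ?thesis unfolding N_def by simp
      qed
      \<comment> \<open>Only the point at position \<open>i\<close> is borrowed from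
        \<open>z'\<close>. It joins the common fibre of \<open>z\<close> because the split points
        have the same image under \<open>p\<close>.\<close>
      define w where "w j = (if j \<le> n then z j else z' i)" for j
      define vs where "vs = map (\<lambda>j. map (w j) [0..<N]) [0..<Suc (Suc n)]"
      have vs: "vs ! j = map (w j) [0..<N]" if "j \<le> Suc n" for j
        unfolding vs_def using that by (subst nth_map) (simp_all del: upt_Suc add: nth_upt)
      have us_z: "z j \<in> list_cylinder (us ! j)" "z' j \<in> list_cylinder (us ! j)" if "j \<le> n" for j
        using conf(1)[OF z(1)] conf(1)[OF z(2)] that len by simp_all
      have "f (w j) \<in> Y \<and> p (f (w j)) = p (f (w 0))" if "j \<le> Suc n" for j
      proof (cases "j \<le> n")
        case True
        then have "f (z j) \<in> Y" "p (f (z j)) = p (f (z 0))"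
          using conf(2,3)[OF z(1), of j] len by simp_all
        then show ?thesis using True unfolding w_def by simp
      next
        case False
        have "p (f (z i)) = p (f (z 0))" "f (z' i) \<in> Y"
          using conf(3)[OF z(1), of i] conf(2)[OF z(2), of i] i len by simp_all
        then show ?thesis using False z(3) unfolding w_def by simp
      qed
      moreover have "w j \<in> list_cylinder (vs ! j)" if "j \<le> Suc n" for j
        unfolding vs[OF that] list_cylinder_map by (simp add: cylinder_def)
      moreover have lvs: "length vs = Suc (Suc n)" unfolding vs_def by simp
      ultimately have "conf Y vs w" unfolding conf_def by (metis less_Suc_eq_le)
      then have "good (Suc n) vs" using lvs unfolding good_def by blast
      moreover have "extends n us vs"
        unfolding extends_def i_def[symmetric]
      proof (intro conjI allI impI)
        fix j assume j: "j \<le> n"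
        show "length (us ! j) < length (vs ! j)" using vs[of j] lenN[OF j] j by simp
        show "take (length (us ! j)) (vs ! j) = us ! j"
          using vs[of j] take_map_list_cylinder[OF us_z(1)[OF j], of N] lenN[OF j] j unfolding w_def by simp
      next
        show "take (length (us ! i)) (vs ! Suc n) = us ! i"
          using vs[of "Suc n"] take_map_list_cylinder[OF us_z(2)[OF i], of N] lenN[OF i] unfolding w_def by simp
        have "cylinder (z i) N \<subseteq> cylinder (z i) M" "cylinder (z' i) N \<subseteq> cylinder (z' i) M'"
          unfolding cylinder_def N_def by auto
        then have "f ` cylinder (z i) N \<subseteq> U" "f ` cylinder (z' i) N \<subseteq> V"
          using M M' by blast+
        moreover have "list_cylinder (vs ! i) = cylinder (z i) N"
            "list_cylinder (vs ! Suc n) = cylinder (z' i) N"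
          using vs[of i] vs[of "Suc n"] i unfolding w_def by (simp_all add: list_cylinder_map)
        ultimately show "f ` list_cylinder (vs ! i) \<inter> f ` list_cylinder (vs ! Suc n) = {}"
          using UV(5) by (metis Int_mono subset_empty)
      qed
      ultimately show ?thesis by blast
    qed
    have "\<exists>us. good 0 us"
    proof -
      have "P \<inter> Y \<noteq> {}"
      proof
        assume "P \<inter> Y = {}"
        then have "P - Y = P" by blast
        then show False using Ys nsmall by simp
      qed
      then obtain \<alpha> where "f \<alpha> \<in> Y" using f(2) by blast
      then have "conf Y [[]] (\<lambda>_. \<alpha>)" unfolding conf_def by simp
      then show ?thesis unfolding good_def by force
    qed
    then obtain x where x: "\<And>n. good n (x n)" "\<And>n. extends n (x n) (x (Suc n))"
      using dependent_nat_choice[of good extends] step by blast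
    have lenx: "m \<le> length (x (j + m) ! j)" for j m
    proof (induct m)
      case (Suc m)
      then show ?case using x(2)[of "j + m"] unfolding extends_def by (auto simp: Suc_le_eq intro: order.strict_trans1)
    qed simp
    have "\<exists>\<beta>. \<forall>m. \<beta> \<in> list_cylinder (x (j + m) ! j)" for j
    proof -
      obtain \<beta> where "\<And>m. \<beta> \<in> list_cylinder (x (j + m) ! j)"
      proof (rule list_cylinder_chain[of "\<lambda>m. x (j + m) ! j"])
        show "length (x (j + m) ! j) < length (x (j + Suc m) ! j)"
          "take (length (x (j + m) ! j)) (x (j + Suc m) ! j) = x (j + m) ! j" for m
          using x(2)[of "j + m"] unfolding extends_def by auto
      qed blast
      then show ?thesis by blast
    qed
    then obtain \<beta> where \<beta>': "\<And>j m. \<beta> j \<in> list_cylinder (x (j + m) ! j)" by metis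
    have \<beta>: "\<beta> j \<in> list_cylinder (x n ! j)" if "j \<le> n" for j n
      using \<beta>'[of j "n - j"] that by simp
    have cyl: "list_cylinder (x n ! j) \<subseteq> cylinder (\<beta> j) m" if "j + m \<le> n" for j m n
    proof -
      have "m \<le> length (x n ! j)"
        using lenx[of "n - j" j] that by simp
      then show ?thesis using \<beta>[of j n] that by (auto simp: list_cylinder_def cylinder_def)
    qed
    have pf: "continuous_on UNIV (\<lambda>\<alpha>. p (f \<alpha>))"
      by (rule continuous_on_compose2[OF p f(1)]) simp
    \<comment> \<open>The limit points are not themselves known to form a configuration; but the
      configuration at a late stage has points near \<open>\<beta> j\<close> and
      \<open>\<beta> 0\<close> in one fibre, and \<open>p\<close> and \<open>f\<close> are
      continuous.\<close>
    have fib: "p (f (\<beta> j)) = p (f (\<beta> 0))" for j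
    proof (rule ccontr)
      assume "p (f (\<beta> j)) \<noteq> p (f (\<beta> 0))"
      then obtain U V where UV: "open U" "open V" "p (f (\<beta> j)) \<in> U" "p (f (\<beta> 0)) \<in> V" "U \<inter> V = {}"
        using hausdorff by metis
      obtain M where M: "cylinder (\<beta> j) M \<subseteq> (\<lambda>\<alpha>. p (f \<alpha>)) -` U"
        using cylinder_subset_open[of "(\<lambda>\<alpha>. p (f \<alpha>)) -` U" "\<beta> j"] UV pf by (auto simp: continuous_on_open_vimage)
      obtain M' where M': "cylinder (\<beta> 0) M' \<subseteq> (\<lambda>\<alpha>. p (f \<alpha>)) -` V"
        using cylinder_subset_open[of "(\<lambda>\<alpha>. p (f \<alpha>)) -` V" "\<beta> 0"] UV pf by (auto simp: continuous_on_open_vimage)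
      define n where "n = j + M + M'"
      obtain z where z: "conf Y (x n) z" "length (x n) = Suc n" using x(1)[of n] unfolding good_def by blast
      then have "z j \<in> list_cylinder (x n ! j)" "z 0 \<in> list_cylinder (x n ! 0)" "p (f (z j)) = p (f (z 0))"
        using conf(1,3)[OF z(1), of j] conf(1)[OF z(1), of 0] unfolding n_def by simp_all
      moreover have "z j \<in> cylinder (\<beta> j) M" "z 0 \<in> cylinder (\<beta> 0) M'"
        using calculation cyl[of j M n] cyl[of 0 M' n] unfolding n_def by auto
      ultimately show False using M M' UV(5) by (metis IntI empty_iff subsetD vimageD)
    qed
    define H where "H = closure (range \<beta>)"
    have "H \<subseteq> {\<alpha>. p (f \<alpha>) = p (f (\<beta> 0))}"
      unfolding H_def by (rule closure_minimal) (use fib in \<open>auto intro!: closed_Collect_eq pf\<close>)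
    then have "f ` H \<subseteq> P \<inter> p -` {p (f (\<beta> 0))}" using f(2) by auto
    then have cH: "countable (f ` H)" using count countable_subset by blast
    have Hne: "\<beta> j \<in> H" for j unfolding H_def by (rule subsetD[OF closure_subset]) simp
    obtain c where c: "top_of_set H interior_of (H \<inter> f -` {c}) \<noteq> {}"
    proof (rule ccontr)
      assume "\<not> thesis"
      then have em: "top_of_set H interior_of (H \<inter> f -` {c}) = {}" for c using that by blast
      have "top_of_set H interior_of \<Union> ((\<lambda>c. H \<inter> f -` {c}) ` f ` H) = {}"
      proof (rule Baire_category_alt)
        show "completely_metrizable_space (top_of_set H) \<or>
            locally_compact_space (top_of_set H) \<and> regular_space (top_of_set H)"
          using completely_metrizable_space_closedin[OF completely_metrizable_space_euclidean, of H]
          unfolding H_def by simp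
        show "countable ((\<lambda>c. H \<inter> f -` {c}) ` f ` H)" using cH by blast
        fix T assume "T \<in> (\<lambda>c. H \<inter> f -` {c}) ` f ` H"
        then obtain c where c: "T = H \<inter> f -` {c}" by blast
        have "closed (f -` {c})" using f(1) by (simp add: continuous_on_closed_vimage)
        then show "closedin (top_of_set H) T \<and> top_of_set H interior_of T = {}"
          using em c by (auto simp: closedin_closed)
      qed
      moreover have "\<Union> ((\<lambda>c. H \<inter> f -` {c}) ` f ` H) = H" by blast
      ultimately have "H = {}" by (metis interior_of_topspace topspace_euclidean_subtopology)
      then show False using Hne by blast
    qed
    then obtain W where W: "open W" "W \<inter> H \<noteq> {}" "W \<inter> H \<subseteq> f -` {c}"
      unfolding interior_of_def by (auto simp: openin_open)
    then obtain j where j: "\<beta> j \<in> W"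
      unfolding H_def by (metis Int_commute open_Int_closure_eq_empty disjoint_iff rangeE)
    obtain M where M: "cylinder (\<beta> j) M \<subseteq> W" using cylinder_subset_open[OF W(1) j] by blast
    \<comment> \<open>This step has target \<open>j\<close> and is late enough for the new point to
      lie in the cylinder around \<open>\<beta> j\<close> of length \<open>M\<close>, where
      \<open>f\<close> is constant on \<open>H\<close>.\<close>
    define n where "n = prod_encode (j, j + M)"
    have n: "j + M \<le> n" "target n = j" unfolding n_def target_def by (simp_all add: le_prod_encode_2)
    have nx: "take (length (x n ! j)) (x (Suc n) ! Suc n) = x n ! j"
      "f ` list_cylinder (x (Suc n) ! j) \<inter> f ` list_cylinder (x (Suc n) ! Suc n) = {}"
      using x(2)[of n] n(2) unfolding extends_def by auto
    have "\<beta> (Suc n) \<in> list_cylinder (x n ! j)"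
      using \<beta>[of "Suc n" "Suc n"] list_cylinder_take[OF nx(1)] by blast
    then have "\<beta> (Suc n) \<in> W" using cyl[OF n(1)] M by blast
    then have "f (\<beta> (Suc n)) = f (\<beta> j)" using W(3) Hne j by blast
    then show False using nx(2) \<beta>[of "Suc n" "Suc n"] \<beta>[of j "Suc n"] n(1) by auto
  qed
  then show ?thesis using that unfolding small_def by blast
qed

section \<open>Category quantifiers\<close>

definition meager :: "'a::topological_space set \<Rightarrow> bool" where
  "meager A \<longleftrightarrow> (\<exists>N :: nat \<Rightarrow> 'a set. (\<forall>n. closed (N n) \<and> interior (N n) = {}) \<and> A \<subseteq> \<Union> (range N))"

lemma meager_subset: "meager B \<Longrightarrow> A \<subseteq> B \<Longrightarrow> meager A"
  unfolding meager_def by (meson subset_trans)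

lemma nowhere_dense_meager: "closed N \<Longrightarrow> interior N = {} \<Longrightarrow> meager N"
  unfolding meager_def by (intro exI[of _ "\<lambda>_. N"]) auto

lemma meager_empty [simp]: "meager {}"
  by (rule nowhere_dense_meager) auto

lemma meager_UN:
  assumes "\<And>n::nat. meager (A n)"
  shows "meager (\<Union>n. A n)"
proof -
  have "\<forall>n. \<exists>N :: nat \<Rightarrow> 'a set. (\<forall>m. closed (N m) \<and> interior (N m) = {}) \<and> A n \<subseteq> \<Union> (range N)"
    using assms unfolding meager_def by blast
  from choice[OF this] obtain N :: "nat \<Rightarrow> nat \<Rightarrow> 'a set"
    where N: "\<forall>n. (\<forall>m. closed (N n m) \<and> interior (N n m) = {}) \<and> A n \<subseteq> \<Union> (range (N n))" ..
  show ?thesis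
    unfolding meager_def
  proof (intro exI[of _ "\<lambda>k. N (fst (prod_decode k)) (snd (prod_decode k))"] conjI allI)
    show "closed (N (fst (prod_decode k)) (snd (prod_decode k)))"
      "interior (N (fst (prod_decode k)) (snd (prod_decode k))) = {}" for k
      using N by simp_all
    show "(\<Union>n. A n) \<subseteq> (\<Union>k. N (fst (prod_decode k)) (snd (prod_decode k)))"
    proof
      fix x assume "x \<in> (\<Union>n. A n)"
      then obtain n m where "x \<in> N n m" using N by blast
      then have "x \<in> N (fst (prod_decode (prod_encode (n, m)))) (snd (prod_decode (prod_encode (n, m))))" by simp
      then show "x \<in> (\<Union>k. N (fst (prod_decode k)) (snd (prod_decode k)))" by (rule UN_I[OF UNIV_I])
    qed
  qed
qed

lemma meager_countable_UN:
  assumes "countable I" "\<And>i. i \<in> I \<Longrightarrow> meager (A i)"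
  shows "meager (\<Union>i\<in>I. A i)"
proof (cases "I = {}")
  case False
  have "(\<Union>i\<in>I. A i) = (\<Union>n. A (from_nat_into I n))"
    using range_from_nat_into[OF False assms(1)] by (metis image_image)
  moreover have "meager (\<Union>n. A (from_nat_into I n))"
    by (intro meager_UN assms(2) from_nat_into[OF False])
  ultimately show ?thesis by simp
qed simp

lemma meager_Un: "meager A \<Longrightarrow> meager B \<Longrightarrow> meager (A \<union> B)"
  using meager_countable_UN[of "{True, False}" "\<lambda>b. if b then A else B"] by (auto simp: Un_commute)

lemma open_not_meager:
  fixes U :: "'a::polish_space set"
  assumes "open U" "U \<noteq> {}"
  shows "\<not> meager U"
proof
  assume "meager U"
  then obtain N :: "nat \<Rightarrow> 'a set" where N: "\<And>n. closed (N n)" "\<And>n. interior (N n) = {}" "U \<subseteq> \<Union> (range N)"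
    unfolding meager_def by blast
  have "euclidean interior_of \<Union> (range N) = {}"
    by (rule Baire_category_alt) (use N completely_metrizable_space_euclidean in auto)
  then show False
    using interior_maximal[OF N(3) assms(1)] assms(2) by simp
qed

lemma meager_vimage_homeomorphism:
  assumes f: "continuous_on UNIV f" and g: "continuous_on UNIV g"
    and fg: "\<And>x. f (g x) = x" and gf: "\<And>x. g (f x) = x" and A: "meager A"
  shows "meager (f -` A)"
proof -
  obtain N where N: "\<And>n::nat. closed (N n)" "\<And>n. interior (N n) = {}" "A \<subseteq> \<Union> (range N)"
    using A unfolding meager_def by blast
  have "interior (f -` N n) = {}" for n
  proof -
    have "open (g -` interior (f -` N n))"
      using g by (simp add: continuous_on_open_vimage)
    moreover have "g -` interior (f -` N n) \<subseteq> N n"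
      using interior_subset[of "f -` N n"] fg by (metis subsetD subsetI vimageD)
    ultimately have "g -` interior (f -` N n) = {}"
      using N(2)[of n] interior_maximal by blast
    then show ?thesis using gf by (metis empty_iff subsetI subset_antisym vimageI empty_subsetI)
  qed
  moreover have "closed (f -` N n)" for n
    using N(1) f by (simp add: continuous_on_closed_vimage)
  moreover have "f -` A \<subseteq> (\<Union>n. f -` N n)" using N(3) by blast
  ultimately show ?thesis unfolding meager_def by (intro exI[of _ "\<lambda>n. f -` N n"]) auto
qed

section \<open>Translations in a topological group\<close>

lemma meager_vimage_add_right:
  fixes A :: "'g::topological_group_add set"
  assumes "meager A"
  shows "meager ((\<lambda>g. g + h) -` A)"
  by (rule meager_vimage_homeomorphism[of _ "\<lambda>g. g - h"]) (auto intro!: continuous_intros assms)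

text \<open>Right translations are the relevant ones: as
  \<open>act (g + h) x = act g (act h x)\<close>, moving the base point from \<open>x\<close> to
  \<open>act h x\<close> translates sets of group elements on the right. Accordingly, the translate
  of \<open>B\<close> at \<open>h\<close> is written \<open>{g. g - h \<in> B}\<close>.\<close>

lemma meager_translate_iff:
  fixes A :: "'g::topological_group_add set"
  shows "meager {g. g + h \<in> A} \<longleftrightarrow> meager A"
proof
  assume "meager A"
  then show "meager {g. g + h \<in> A}" using meager_vimage_add_right[of A h] by (simp add: vimage_def)
next
  assume "meager {g. g + h \<in> A}"
  then have "meager ((\<lambda>g. g + - h) -` {g. g + h \<in> A})" by (rule meager_vimage_add_right)
  moreover have "(\<lambda>g. g + - h) -` {g. g + h \<in> A} = A" by (auto simp: add.assoc)
  ultimately show "meager A" by simp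
qed

lemma add_diff_add_right_cancel: "(g + u) - (k + u) = g - (k :: 'g::group_add)"
  by (simp only: diff_conv_add_uminus minus_add add.assoc add_minus_cancel)

lemma open_translate:
  fixes B :: "'g::topological_group_add set"
  assumes "open B"
  shows "open {g. g - h \<in> B}"
  using open_vimage[OF assms continuous_on_diff[OF continuous_on_id continuous_on_const], of h]
  by (simp add: vimage_def)

lemma borel_Baire_property:
  assumes "A \<in> sets borel"
  obtains U where "open U" "meager (A - U)" "meager (U - A)"
proof -
  have "A \<in> sigma_sets UNIV {S. open S}"
    using assms by (simp add: borel_def)
  then have "\<exists>U. open U \<and> meager (A - U) \<and> meager (U - A)"
  proof induct
    case (Basic A)
    then show ?case by (intro exI[of _ A]) auto
  next
    case Empty
    show ?case by (intro exI[of _ "{}"]) auto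
  next
    case (Compl A)
    then obtain U where U: "open U" "meager (A - U)" "meager (U - A)" by blast
    \<comment> \<open>The closed set \<open>- U\<close> differs from its interior only by a closed
      nowhere dense set, so this interior serves as the open set for the complement.\<close>
    have "interior (- U - interior (- U)) = {}"
    proof -
      have "interior (- U - interior (- U)) \<subseteq> interior (- U)"
        by (rule interior_mono) blast
      moreover have "interior (- U - interior (- U)) \<subseteq> - U - interior (- U)"
        by (rule interior_subset)
      ultimately show ?thesis by blast
    qed
    then have "meager (- U - interior (- U))"
      using U(1) by (intro nowhere_dense_meager) (auto intro: closed_Diff)
    then have "meager ((U - A) \<union> (- U - interior (- U)))" using U(3) meager_Un by blast
    then have "meager (UNIV - A - interior (- U))"
      by (rule meager_subset) blast
    moreover have "meager (interior (- U) - (UNIV - A))"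
      using U(2) by (rule meager_subset) (use interior_subset in blast)
    ultimately show ?case by (intro exI[of _ "interior (- U)"]) auto
  next
    case (Union A)
    then obtain U where U: "\<And>n. open (U n)" "\<And>n. meager (A n - U n)" "\<And>n. meager (U n - A n)" by metis
    show ?case
    proof (intro exI[of _ "\<Union>n. U n"] conjI)
      show "open (\<Union>n. U n)" using U(1) by blast
      show "meager ((\<Union>n. A n) - (\<Union>n. U n))"
        by (rule meager_subset[OF meager_UN[of "\<lambda>n. A n - U n"]]) (use U in blast)+
      show "meager ((\<Union>n. U n) - (\<Union>n. A n))"
        by (rule meager_subset[OF meager_UN[of "\<lambda>n. U n - A n"]]) (use U in blast)+
    qed
  qed
  then show ?thesis using that by blast
qed

text \<open>A fixed enumeration of a countable base, so that quantifiers over open sets become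
  countable. Members may be empty, hence the explicit nonemptiness conditions later on.\<close>

definition basic_open :: "nat \<Rightarrow> 'a::second_countable_topology set" where
  "basic_open = (SOME B. (\<forall>n. open (B n)) \<and> (\<forall>U x. open U \<longrightarrow> x \<in> U \<longrightarrow> (\<exists>n. x \<in> B n \<and> B n \<subseteq> U)))"

lemma basic_open_props:
  "(\<forall>n. open (basic_open n :: 'a::second_countable_topology set)) \<and>
   (\<forall>U. \<forall>x::'a. open U \<longrightarrow> x \<in> U \<longrightarrow> (\<exists>n. x \<in> basic_open n \<and> basic_open n \<subseteq> U))"
proof -
  obtain \<B> :: "'a set set" where \<B>: "countable \<B>" "topological_basis \<B>"
    using ex_countable_basis by blast
  have ne: "\<B> \<noteq> {}" using topological_basisE[OF \<B>(2) open_UNIV UNIV_I] by blast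
  have ex: "\<exists>B :: nat \<Rightarrow> 'a set. (\<forall>n. open (B n)) \<and> (\<forall>U x. open U \<longrightarrow> x \<in> U \<longrightarrow> (\<exists>n. x \<in> B n \<and> B n \<subseteq> U))"
  proof (intro exI[of _ "from_nat_into \<B>"] conjI allI impI)
    show "open (from_nat_into \<B> n)" for n
      using \<B>(2) from_nat_into[OF ne] topological_basis_open by blast
    fix U and x :: 'a assume "open U" "x \<in> U"
    then obtain B where B: "B \<in> \<B>" "x \<in> B" "B \<subseteq> U"
      using topological_basisE[OF \<B>(2)] by metis
    moreover obtain n where "from_nat_into \<B> n = B"
      using from_nat_into_surj[OF \<B>(1) B(1)] by blast
    ultimately show "\<exists>n. x \<in> from_nat_into \<B> n \<and> from_nat_into \<B> n \<subseteq> U" by blast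
  qed
  from someI_ex[OF ex] show ?thesis unfolding basic_open_def .
qed

lemma open_basic_open [simp]: "open (basic_open n)"
  using basic_open_props by blast

lemma basic_openE:
  assumes "open U" "x \<in> U"
  obtains n where "x \<in> basic_open n" "basic_open n \<subseteq> U"
  using basic_open_props assms by blast

lemma nonmeager_borel_localization:
  fixes A :: "'a::polish_space set"
  assumes "A \<in> sets borel" "open U" "\<not> meager (U \<inter> A)"
  obtains n where "basic_open n \<noteq> ({} :: 'a set)" "basic_open n \<subseteq> U" "meager (basic_open n - A)"
proof -
  obtain V where V: "open V" "meager (U \<inter> A - V)" "meager (V - U \<inter> A)"
    using borel_Baire_property[of "U \<inter> A"] assms by auto
  have "U \<inter> V \<noteq> {}"
  proof
    assume "U \<inter> V = {}"
    then have "U \<inter> A - V = U \<inter> A" by blast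
    then show False using V(2) assms(3) by simp
  qed
  then obtain x where "x \<in> U \<inter> V" by blast
  then obtain n where n: "x \<in> basic_open n" "basic_open n \<subseteq> U \<inter> V"
    using basic_openE[of "U \<inter> V" x] V(1) assms(2) by blast
  show ?thesis
  proof (rule that)
    show "basic_open n \<noteq> ({} :: 'a set)" "basic_open n \<subseteq> U" using n by auto
    show "meager (basic_open n - A)"
      using V(3) by (rule meager_subset) (use n in blast)
  qed
qed

text \<open>The induction over the product sigma-algebra handles all open \<open>U\<close>
  simultaneously: the complement of a section is nonmeager in \<open>U\<close> iff the section is
  meager in some nonempty basic open subset of \<open>U\<close>.\<close>

lemma sets_nonmeager_section:
  fixes M :: "('g::polish_space \<times> 'x) set"
  assumes "M \<in> sets (borel \<Otimes>\<^sub>M X)" "open U"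
  shows "{x \<in> space X. \<not> meager (U \<inter> {g. (g, x) \<in> M})} \<in> sets X"
proof -
  have "M \<in> sigma_sets (space borel \<times> space X) {a \<times> b | a b. a \<in> sets borel \<and> b \<in> sets X}"
    using assms(1) by (simp add: sets_pair_measure)
  then have "open U \<longrightarrow> {x \<in> space X. \<not> meager (U \<inter> {g. (g, x) \<in> M})} \<in> sets X"
  proof (induct arbitrary: U)
    case (Basic M)
    then obtain a b where ab: "M = a \<times> b" "b \<in> sets X" by blast
    have "{x \<in> space X. \<not> meager (U \<inter> {g. (g, x) \<in> M})} = (if meager (U \<inter> a) then {} else b)"
    proof -
      have "{g. (g, x) \<in> M} = (if x \<in> b then a else {})" for x using ab by auto
      then show ?thesis using sets.sets_into_space[OF ab(2)] by auto
    qed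
    then show ?case using ab by auto
  next
    case Empty
    show ?case by simp
  next
    case (Compl M)
    then have M: "M \<in> sets (borel \<Otimes>\<^sub>M X)" by (simp add: sets_pair_measure)
    show ?case
    proof
      assume U: "open U"
      define J where "J = {j. basic_open j \<noteq> ({} :: 'g set) \<and> basic_open j \<subseteq> U}"
      have "\<not> meager (U \<inter> {g. (g, x) \<in> space borel \<times> space X - M}) \<longleftrightarrow>
          (\<exists>j\<in>J. meager (basic_open j \<inter> {g. (g, x) \<in> M}))" if x: "x \<in> space X" for x
      proof
        have eq: "{g. (g, x) \<in> space borel \<times> space X - M} = - {g. (g, x) \<in> M}" using x by auto
        have b: "- {g. (g, x) \<in> M} \<in> sets borel"
          using sets_Pair2[OF M, of x] by (auto simp: vimage_def intro: borel_comp)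
        {
          assume "\<not> meager (U \<inter> {g. (g, x) \<in> space borel \<times> space X - M})"
          then obtain j where "basic_open j \<noteq> ({} :: 'g set)" "basic_open j \<subseteq> U"
              "meager (basic_open j - - {g. (g, x) \<in> M})"
            using nonmeager_borel_localization[OF b U] unfolding eq by blast
          then show "\<exists>j\<in>J. meager (basic_open j \<inter> {g. (g, x) \<in> M})"
            unfolding J_def by (auto simp: Diff_eq)
        }
        {
          assume "\<exists>j\<in>J. meager (basic_open j \<inter> {g. (g, x) \<in> M})"
          then obtain j where j: "j \<in> J" "meager (basic_open j \<inter> {g. (g, x) \<in> M})" by blast
          show "\<not> meager (U \<inter> {g. (g, x) \<in> space borel \<times> space X - M})"
          proof
            assume "meager (U \<inter> {g. (g, x) \<in> space borel \<times> space X - M})"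
            from meager_Un[OF this j(2)] have "meager (basic_open j :: 'g set)"
              by (rule meager_subset) (use j(1) eq in \<open>auto simp: J_def\<close>)
            then show False using open_not_meager[OF open_basic_open] j(1) unfolding J_def by blast
          qed
        }
      qed
      then have "{x \<in> space X. \<not> meager (U \<inter> {g. (g, x) \<in> space borel \<times> space X - M})} =
          (\<Union>j\<in>J. space X - {x \<in> space X. \<not> meager (basic_open j \<inter> {g. (g, x) \<in> M})})"
        by blast
      also have "\<dots> \<in> sets X"
        using Compl(2) by (intro sets.countable_UN' sets.compl_sets) auto
      finally show "{x \<in> space X. \<not> meager (U \<inter> {g. (g, x) \<in> space borel \<times> space X - M})} \<in> sets X" .
    qed
  next
    case (Union M)
    show ?case
    proof
      assume U: "open U"
      have "meager (U \<inter> {g. (g, x) \<in> (\<Union>n. M n)}) \<longleftrightarrow> (\<forall>n. meager (U \<inter> {g. (g, x) \<in> M n}))" for x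
      proof -
        have "U \<inter> {g. (g, x) \<in> (\<Union>n. M n)} = (\<Union>n. U \<inter> {g. (g, x) \<in> M n})" by blast
        then show ?thesis
          using meager_UN[of "\<lambda>n. U \<inter> {g. (g, x) \<in> M n}"] meager_subset
          by (metis (no_types, lifting) UN_upper UNIV_I)
      qed
      then have "{x \<in> space X. \<not> meager (U \<inter> {g. (g, x) \<in> (\<Union>n. M n)})} =
          (\<Union>n. {x \<in> space X. \<not> meager (U \<inter> {g. (g, x) \<in> M n})})" by blast
      also have "\<dots> \<in> sets X" using Union(2) U by (intro sets.countable_UN) auto
      finally show "{x \<in> space X. \<not> meager (U \<inter> {g. (g, x) \<in> (\<Union>n. M n)})} \<in> sets X" .
    qed
  qed
  then show ?thesis using assms(2) by blast
qed

section \<open>Countable unions of open-by-measurable rectangles\<close>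

definition open_measurable :: "'x measure \<Rightarrow> ('g::topological_space \<times> 'x) set \<Rightarrow> bool" where
  "open_measurable X W \<longleftrightarrow> (\<exists>(V :: nat \<Rightarrow> 'g set) D. (\<forall>l. open (V l) \<and> D l \<in> sets X) \<and> W = (\<Union>l. V l \<times> D l))"

lemma open_measurableE:
  fixes W :: "('g::topological_space \<times> 'x) set"
  assumes "open_measurable X W"
  obtains V :: "nat \<Rightarrow> 'g set" and D
  where "\<And>l. open (V l)" "\<And>l. D l \<in> sets X" "W = (\<Union>l. V l \<times> D l)"
  using assms unfolding open_measurable_def by (elim exE conjE) (rule that, auto)

lemma open_measurable_Times: "open V \<Longrightarrow> D \<in> sets X \<Longrightarrow> open_measurable X (V \<times> D)"
  unfolding open_measurable_def by (intro exI[of _ "\<lambda>_. V"] exI[of _ "\<lambda>_. D"]) auto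

lemma open_measurable_empty [simp]: "open_measurable X {}"
  using open_measurable_Times[of "{}" "{}" X] by simp

lemma open_measurable_countable_UN:
  assumes "countable I" "\<And>i. i \<in> I \<Longrightarrow> open_measurable X (W i)"
  shows "open_measurable X (\<Union>i\<in>I. W i :: ('g::topological_space \<times> 'x) set)"
proof (cases "I = {}")
  case False
  have "\<forall>i. \<exists>V :: nat \<Rightarrow> 'g set. i \<in> I \<longrightarrow> (\<exists>D. (\<forall>l. open (V l) \<and> D l \<in> sets X) \<and> W i = (\<Union>l. V l \<times> D l))"
    using assms(2) unfolding open_measurable_def by blast
  from choice[OF this] obtain V :: "_ \<Rightarrow> nat \<Rightarrow> 'g set"
    where "\<forall>i. i \<in> I \<longrightarrow> (\<exists>D. (\<forall>l. open (V i l) \<and> D l \<in> sets X) \<and> W i = (\<Union>l. V i l \<times> D l))" ..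
  then have "\<forall>i. \<exists>D. i \<in> I \<longrightarrow> (\<forall>l. open (V i l) \<and> D l \<in> sets X) \<and> W i = (\<Union>l. V i l \<times> D l)" by blast
  from choice[OF this] obtain D
    where VD: "\<forall>i. i \<in> I \<longrightarrow> (\<forall>l. open (V i l) \<and> D i l \<in> sets X) \<and> W i = (\<Union>l. V i l \<times> D i l)" ..
  define e where "e k = (from_nat_into I (fst (prod_decode k)), snd (prod_decode k))" for k
  have e: "range e = I \<times> UNIV"
  proof -
    have "range e = (\<lambda>(a, l). (from_nat_into I a, l)) ` range prod_decode"
      unfolding e_def image_image by (simp add: case_prod_unfold)
    also have "\<dots> = I \<times> UNIV"
      using range_from_nat_into[OF False assms(1)] surj_prod_decode by (force simp: image_iff)
    finally show ?thesis .
  qed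
  have eI: "fst (e k) \<in> I" for k using e by (metis mem_Times_iff rangeI)
  have "(\<Union>i\<in>I. W i) = (\<Union>i\<in>I. \<Union>l. V i l \<times> D i l)" using VD by simp
  also have "\<dots> = (\<Union>il\<in>I \<times> UNIV. V (fst il) (snd il) \<times> D (fst il) (snd il))"
    by fastforce
  also have "\<dots> = (\<Union>k. V (fst (e k)) (snd (e k)) \<times> D (fst (e k)) (snd (e k)))"
    unfolding e[symmetric] by (simp add: image_image)
  finally show ?thesis
    unfolding open_measurable_def using VD eI
    by (intro exI[of _ "\<lambda>k. V (fst (e k)) (snd (e k))"] exI[of _ "\<lambda>k. D (fst (e k)) (snd (e k))"]) auto
qed simp

lemma open_measurable_Int:
  assumes "open_measurable X W" "open_measurable X W'"
  shows "open_measurable X (W \<inter> W' :: ('g::topological_space \<times> 'x) set)"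
proof -
  obtain V :: "nat \<Rightarrow> 'g set" and D where VD: "\<And>l. open (V l)" "\<And>l. D l \<in> sets X" "W = (\<Union>l. V l \<times> D l)"
    by (rule open_measurableE[OF assms(1)]) (rule that)
  obtain V' :: "nat \<Rightarrow> 'g set" and D' where VD': "\<And>l. open (V' l)" "\<And>l. D' l \<in> sets X" "W' = (\<Union>l. V' l \<times> D' l)"
    by (rule open_measurableE[OF assms(2)]) (rule that)
  have "W \<inter> W' = (\<Union>l\<in>UNIV. \<Union>m\<in>UNIV. (V l \<inter> V' m) \<times> (D l \<inter> D' m))"
    unfolding VD(3) VD'(3) by blast
  also have "open_measurable X \<dots>"
    using VD VD' by (intro open_measurable_countable_UN open_measurable_Times open_Int sets.Int) auto
  finally show ?thesis .
qed

lemma open_measurable_finite_INT: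
  assumes "finite I" "\<And>i. i \<in> I \<Longrightarrow> open_measurable X (W i)"
  shows "open_measurable X ((UNIV \<times> space X) \<inter> (\<Inter>i\<in>I. W i) :: ('g::topological_space \<times> 'x) set)"
  using assms
proof induct
  case empty
  then show ?case using open_measurable_Times[OF open_UNIV sets.top] by simp
next
  case (insert i I)
  have "UNIV \<times> space X \<inter> (\<Inter>i\<in>insert i I. W i) = W i \<inter> (UNIV \<times> space X \<inter> (\<Inter>i\<in>I. W i))" by blast
  then show ?case using insert by (simp add: open_measurable_Int)
qed

lemma open_section_open_measurable:
  assumes "open_measurable X W"
  shows "open {g. (g, x) \<in> W}"
proof -
  obtain V :: "nat \<Rightarrow> _ set" and D
    where VD: "\<And>l. open (V l)" "\<And>l. D l \<in> sets X" "W = (\<Union>l. V l \<times> D l)"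
    by (rule open_measurableE[OF assms]) (rule that)
  have "{g. (g, x) \<in> W} = (\<Union>l\<in>{l. x \<in> D l}. V l)" unfolding VD(3) by blast
  then show ?thesis using VD(1) by auto
qed

lemma sets_open_measurable:
  assumes "open_measurable X W"
  shows "W \<in> sets (borel \<Otimes>\<^sub>M X)"
  using assms unfolding open_measurable_def by auto

text \<open>By compactness finitely many of the rectangles already cover \<open>K\<close>, and there
  are only countably many finite sets of indices. The rectangles thus make a universal quantifier
  over a compact set Borel; its dual is a projection along \<open>K\<close>.\<close>

lemma sets_compact_subset_section:
  assumes W: "open_measurable X W" and K: "compact (K :: 'g::topological_space set)"
  shows "{x \<in> space X. K \<subseteq> {g. (g, x) \<in> W}} \<in> sets X"
proof -
  obtain V :: "nat \<Rightarrow> 'g set" and D where VD: "\<And>l. open (V l)" "\<And>l. D l \<in> sets X" "W = (\<Union>l. V l \<times> D l)"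
    by (rule open_measurableE[OF W]) (rule that)
  define \<F> where "\<F> = {F. finite F \<and> K \<subseteq> (\<Union>l\<in>F. V l)}"
  have "\<F> \<subseteq> Collect finite" unfolding \<F>_def by blast
  then have c: "countable \<F>" using countable_Collect_finite countable_subset by blast
  have eq: "{x \<in> space X. K \<subseteq> {g. (g, x) \<in> W}} = (\<Union>F\<in>\<F>. {x \<in> space X. \<forall>l\<in>F. x \<in> D l})"
  proof (intro equalityI subsetI)
    fix x assume x: "x \<in> {x \<in> space X. K \<subseteq> {g. (g, x) \<in> W}}"
    then have "K \<subseteq> (\<Union>l\<in>{l. x \<in> D l}. V l)" unfolding VD(3) by blast
    then obtain F where "F \<subseteq> {l. x \<in> D l}" "finite F" "K \<subseteq> (\<Union>l\<in>F. V l)"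
      using compactE_image[OF K, of "{l. x \<in> D l}" V] VD(1) by blast
    then show "x \<in> (\<Union>F\<in>\<F>. {x \<in> space X. \<forall>l\<in>F. x \<in> D l})"
      using x unfolding \<F>_def by blast
  next
    fix x assume "x \<in> (\<Union>F\<in>\<F>. {x \<in> space X. \<forall>l\<in>F. x \<in> D l})"
    then obtain F where F: "K \<subseteq> (\<Union>l\<in>F. V l)" "x \<in> space X" "\<forall>l\<in>F. x \<in> D l"
      unfolding \<F>_def by blast
    have "g \<in> {g. (g, x) \<in> W}" if "g \<in> K" for g
    proof -
      obtain l where "l \<in> F" "g \<in> V l" using subsetD[OF F(1) \<open>g \<in> K\<close>] by (elim UN_E)
      then have "(g, x) \<in> V l \<times> D l" using F(3) by blast
      then show ?thesis unfolding VD(3) by blast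
    qed
    then show "x \<in> {x \<in> space X. K \<subseteq> {g. (g, x) \<in> W}}" using F(2) by blast
  qed
  show ?thesis
    unfolding eq
  proof (rule sets.countable_UN''[OF c])
    show "{x \<in> space X. \<forall>l\<in>F. x \<in> D l} \<in> sets X" if "F \<in> \<F>" for F
    proof (cases "F = {}")
      case False
      have "finite F" using that unfolding \<F>_def by blast
      then have "space X \<inter> (\<Inter>l\<in>F. D l) \<in> sets X"
        using VD(2) False by (intro sets.Int sets.top sets.finite_INT)
      moreover have "{x \<in> space X. \<forall>l\<in>F. x \<in> D l} = space X \<inter> (\<Inter>l\<in>F. D l)" by blast
      ultimately show ?thesis by (simp only:)
    qed simp
  qed
qed

text \<open>Continuity of subtraction covers \<open>{(g, h). g - h \<in> U}\<close> by basic
  rectangles, and a set is nonmeager in a countable union of open sets iff it is so in one of them.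
  The dependence on \<open>h\<close> is thereby reduced to membership in basic open sets.\<close>

lemma open_measurable_nonmeager_translate:
  fixes M :: "('g::{topological_group_add, polish_space} \<times> 'x) set"
  assumes M: "M \<in> sets (borel \<Otimes>\<^sub>M X)" and U: "open U"
  shows "open_measurable X {(h, x). x \<in> space X \<and> \<not> meager ({g. g - h \<in> U} \<inter> {g. (g, x) \<in> M})}"
    (is "open_measurable X ?W")
proof -
  define I where "I = {(i, j). \<forall>h\<in>basic_open i. \<forall>g\<in>basic_open j. g - h \<in> U}"
  have "?W = (\<Union>ij\<in>I. basic_open (fst ij) \<times> {x \<in> space X. \<not> meager (basic_open (snd ij) \<inter> {g. (g, x) \<in> M})})"
  proof (intro equalityI subsetI)
    fix p assume "p \<in> ?W"
    then obtain h x where p: "p = (h, x)" "x \<in> space X" "\<not> meager ({g. g - h \<in> U} \<inter> {g. (g, x) \<in> M})" by blast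
    define J where "J = {j. \<exists>i. h \<in> basic_open i \<and> (i, j) \<in> I}"
    have "{g. g - h \<in> U} \<subseteq> (\<Union>j\<in>J. basic_open j)"
    proof clarify
      fix g assume g: "g - h \<in> U"
      have "open ((\<lambda>q. fst q - snd q) -` U)"
        using U by (intro open_vimage continuous_intros)
      then obtain A C where AC: "open A" "open C" "g \<in> A" "h \<in> C" "A \<times> C \<subseteq> (\<lambda>q. fst q - snd q) -` U"
        using g by (elim open_prod_elim[of _ "(g, h)"]) auto
      obtain j where j: "g \<in> basic_open j" "basic_open j \<subseteq> A" using basic_openE[OF AC(1,3)] by blast
      obtain i where i: "h \<in> basic_open i" "basic_open i \<subseteq> C" using basic_openE[OF AC(2,4)] by blast
      have "(i, j) \<in> I" unfolding I_def using i j AC(5) by fastforce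
      then show "g \<in> (\<Union>j\<in>J. basic_open j)" using i j unfolding J_def by blast
    qed
    then have "{g. g - h \<in> U} \<inter> {g. (g, x) \<in> M} \<subseteq> (\<Union>j\<in>J. basic_open j \<inter> {g. (g, x) \<in> M})" by blast
    then have "\<not> meager (\<Union>j\<in>J. basic_open j \<inter> {g. (g, x) \<in> M})" using p(3) meager_subset by blast
    then have "\<exists>j\<in>J. \<not> meager (basic_open j \<inter> {g. (g, x) \<in> M})"
      using meager_countable_UN[OF countableI_type] by (rule contrapos_np) simp
    then obtain j where "j \<in> J" "\<not> meager (basic_open j \<inter> {g. (g, x) \<in> M})" ..
    then show "p \<in> (\<Union>ij\<in>I. basic_open (fst ij) \<times> {x \<in> space X. \<not> meager (basic_open (snd ij) \<inter> {g. (g, x) \<in> M})})"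
      using p(1,2) unfolding J_def by force
  next
    fix p :: "'g \<times> 'x" assume "p \<in> (\<Union>ij\<in>I. basic_open (fst ij) \<times> {x \<in> space X. \<not> meager (basic_open (snd ij) \<inter> {g. (g, x) \<in> M})})"
    then obtain i j h x where ij: "(i, j) \<in> I" "p = (h, x)" "h \<in> basic_open i" "x \<in> space X"
        "\<not> meager (basic_open j \<inter> {g. (g, x) \<in> M})" by auto
    have "basic_open j \<inter> {g. (g, x) \<in> M} \<subseteq> {g. g - h \<in> U} \<inter> {g. (g, x) \<in> M}"
      using ij(1,3) unfolding I_def by blast
    then show "p \<in> ?W" using ij meager_subset by blast
  qed
  also have "open_measurable X \<dots>"
    using sets_nonmeager_section[OF M open_basic_open]
    by (intro open_measurable_countable_UN open_measurable_Times) auto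
  finally show ?thesis .
qed

section \<open>Standard Borel spaces\<close>

text \<open>The coordinates are the distances to a dense sequence, which give a homeomorphism onto
  the image. The image is completely metrizable, hence a G-delta, and so Borel sets have Borel
  images.\<close>

lemma standard_borel_embedding:
  assumes "standard_borel_space X"
  obtains e :: "'x \<Rightarrow> nat \<Rightarrow> real"
  where "e \<in> borel_measurable X" "inj_on e (space X)" "\<And>A. A \<in> sets X \<Longrightarrow> e ` A \<in> sets borel"
proof (cases "space X = {}")
  case True
  then have "A = {}" if "A \<in> sets X" for A using sets.sets_into_space[OF that] by blast
  then have "(\<lambda>_ _. 0 :: real) ` A \<in> sets borel" if "A \<in> sets X" for A
    using that by fastforce
  moreover have "inj_on (\<lambda>_ _. 0 :: real) (space X)" using True by simp
  ultimately show ?thesis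
    by (intro that[of "\<lambda>_ _. 0"] borel_measurable_const)
next
  case False
  obtain T where T: "completely_metrizable_space T" "second_countable T" "topspace T = space X"
      "sets X = sigma_sets (topspace T) {U. openin T U}"
    using assms unfolding standard_borel_space_def by blast
  obtain M d where Md: "Metric_space M d" "T = Metric_space.mtopology M d"
    using T(1) unfolding completely_metrizable_space_def by blast
  interpret Metric_space M d by (rule Md(1))
  have M: "M = space X" using T(3) Md(2) by simp
  obtain C where C: "countable C" "C \<subseteq> M" "mtopology closure_of C = M"
    using second_countable_imp_separable_space[OF T(2)] Md(2) unfolding separable_space_def by auto
  have "C \<noteq> {}" using C(3) False M by auto
  define q where "q = from_nat_into C"
  have qM: "q j \<in> M" for j
    unfolding q_def using from_nat_into[OF \<open>C \<noteq> {}\<close>] C(2) by blast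
  have dense: "\<exists>j. d (q j) x < r" if "x \<in> M" "r > 0" for x r
  proof -
    have "x \<in> mtopology closure_of C" using that C(3) by simp
    then obtain y where y: "y \<in> C" "d x y < r"
      using \<open>r > 0\<close> unfolding metric_closure_of by auto
    then obtain j where "q j = y" unfolding q_def using from_nat_into_surj[OF C(1)] by blast
    then show ?thesis using y commute by metis
  qed
  define e where "e x j = d (q j) x" for x j
  have econt: "continuous_map T euclidean e"
    unfolding euclidean_product_topology[symmetric] continuous_map_componentwise_UNIV
  proof
    fix j
    show "continuous_map T euclideanreal (\<lambda>x. e x j)"
      unfolding e_def Md(2) using continuous_on_mdist[of "q j" "metric (M, d)"] qM[of j] by simp
  qed
  have sub: "\<exists>O'. open O' \<and> e x \<in> O' \<and> (\<forall>y\<in>M. e y \<in> O' \<longrightarrow> y \<in> U)" if U: "openin T U" "x \<in> U" for U x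
  proof -
    obtain r where r: "r > 0" "mball x r \<subseteq> U" "x \<in> M"
      using U unfolding Md(2) openin_mtopology by blast
    obtain j where j: "d (q j) x < r / 2" using dense[of x "r / 2"] r by auto
    have "open {z::nat \<Rightarrow> real. z j < r / 2}"
      by (intro open_Collect_less continuous_intros continuous_on_product_coordinates)
    moreover have "y \<in> U" if y: "y \<in> M" "e y j < r / 2" for y
    proof -
      have "d x y \<le> d (q j) x + d (q j) y"
        using triangle[OF r(3) qM[of j] y(1)] commute[of x "q j"] by simp
      then have "d x y < r" using j y(2) unfolding e_def by simp
      then show ?thesis using r y(1) by auto
    qed
    ultimately show ?thesis
      using j unfolding e_def by (intro exI[of _ "{z. z j < r / 2}"]) auto
  qed
  have einj: "inj_on e M"
  proof (rule inj_onI, rule ccontr)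
    fix x y assume xy: "x \<in> M" "y \<in> M" "e x = e y" "x \<noteq> y"
    then have "d x y / 2 > 0" by simp
    then obtain j where j: "d (q j) x < d x y / 2" using dense[OF xy(1)] by blast
    moreover have "d x y \<le> d (q j) x + d (q j) y"
      using triangle[OF xy(1) qM[of j] xy(2)] commute[of x "q j"] by simp
    moreover have "d (q j) x = d (q j) y" using xy(3) unfolding e_def by meson
    ultimately show False by linarith
  qed
  have eopen: "openin (top_of_set (e ` M)) (e ` U)" if U: "openin T U" for U
  proof -
    have UM: "U \<subseteq> M" using openin_subset[OF U] T(3) M by simp
    define W where "W = \<Union>{O'. open O' \<and> (\<forall>y\<in>M. e y \<in> O' \<longrightarrow> y \<in> U)}"
    have "open W" unfolding W_def by blast
    moreover have "e ` U = e ` M \<inter> W"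
    proof
      show "e ` U \<subseteq> e ` M \<inter> W"
        using sub[OF U] UM unfolding W_def by blast
      show "e ` M \<inter> W \<subseteq> e ` U" unfolding W_def by blast
    qed
    ultimately show ?thesis unfolding openin_open by blast
  qed
  have "homeomorphic_map T (top_of_set (e ` M)) e"
  proof (rule bijective_open_imp_homeomorphic_map)
    show "continuous_map T (top_of_set (e ` M)) e"
      using econt T(3) M by (simp add: continuous_map_in_subtopology image_subset_iff_funcset)
    show "open_map T (top_of_set (e ` M)) e" using eopen unfolding open_map_def by blast
  qed (use einj T(3) M in auto)
  then have "completely_metrizable_space (top_of_set (e ` M))"
    using T(1) homeomorphic_map_imp_homeomorphic_space homeomorphic_completely_metrizable_space by blast
  then have "gdelta_in euclidean (e ` M)"
    by (intro completely_metrizable_space_imp_gdelta_in metrizable_space_euclidean) auto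
  then obtain G :: "nat \<Rightarrow> (nat \<Rightarrow> real) set" where G: "\<And>n. open (G n)" "\<Inter> (range G) = e ` M"
    unfolding gdelta_in_descending by auto
  have eM: "e ` M \<in> sets borel"
    unfolding G(2)[symmetric] using G(1) by (intro sets.countable_INT) auto
  show ?thesis
  proof (rule that)
    show "e \<in> borel_measurable X"
    proof (rule borel_measurableI)
      fix S :: "(nat \<Rightarrow> real) set" assume "open S"
      then have "openin T {x \<in> topspace T. e x \<in> S}"
        using econt unfolding continuous_map_def by simp
      moreover have "e -` S \<inter> space X = {x \<in> topspace T. e x \<in> S}" using T(3) by auto
      ultimately show "e -` S \<inter> space X \<in> sets X" unfolding T(4) by auto
    qed
    show "inj_on e (space X)" using einj M by simp
    fix A assume "A \<in> sets X"
    then show "e ` A \<in> sets borel"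
      unfolding T(4)
    proof induct
      case (Basic U)
      then obtain W where W: "open W" "e ` U = e ` M \<inter> W" using eopen[of U] unfolding openin_open by blast
      show ?case unfolding W(2) using eM W(1) by (intro sets.Int) auto
    next
      case Empty
      show ?case by simp
    next
      case (Compl A)
      have "A \<subseteq> M" using sigma_sets_into_sp[OF _ Compl(1)] openin_subset[of T] T(3) M by blast
      then have "e ` (topspace T - A) = e ` M - e ` A"
        using einj T(3) M by (simp add: inj_on_image_set_diff[of e M])
      then show ?case using eM Compl(2) by (simp add: sets.Diff)
    next
      case (Union A)
      then show ?case unfolding image_UN by (intro sets.countable_UN) auto
    qed
  qed
qed

lemma standard_borel_sets_diagonal:
  assumes "standard_borel_space X"
  shows "{p \<in> space (X \<Otimes>\<^sub>M X). fst p = snd p} \<in> sets (X \<Otimes>\<^sub>M X)"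
proof -
  obtain e :: "'a \<Rightarrow> nat \<Rightarrow> real" where [measurable]: "e \<in> borel_measurable X" and e: "inj_on e (space X)"
    by (rule standard_borel_embedding[OF assms]) (rule that)
  have "{p \<in> space (X \<Otimes>\<^sub>M X). fst p = snd p} = {p \<in> space (X \<Otimes>\<^sub>M X). e (fst p) = e (snd p)}"
    by (intro Collect_cong conj_cong refl inj_on_eq_iff[OF e, symmetric])
      (simp_all add: space_pair_measure mem_Times_iff)
  also have "\<dots> \<in> sets (X \<Otimes>\<^sub>M X)" by measurable
  finally show ?thesis .
qed

lemma standard_borel_separating_sequence:
  assumes "standard_borel_space X"
  obtains A :: "nat \<Rightarrow> 'x set" where "\<And>i. A i \<in> sets X"
    "\<And>x y. x \<in> space X \<Longrightarrow> y \<in> space X \<Longrightarrow> \<forall>i. x \<in> A i \<longleftrightarrow> y \<in> A i \<Longrightarrow> x = y"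
proof -
  obtain e :: "'x \<Rightarrow> nat \<Rightarrow> real" where em: "e \<in> borel_measurable X" and e: "inj_on e (space X)"
    by (rule standard_borel_embedding[OF assms]) (rule that)
  show ?thesis
  proof (rule that[of "\<lambda>i. e -` basic_open i \<inter> space X"])
    show "e -` basic_open i \<inter> space X \<in> sets X" for i
      by (rule measurable_sets[OF em]) simp
    fix x y assume xy: "x \<in> space X" "y \<in> space X"
      "\<forall>i. x \<in> e -` basic_open i \<inter> space X \<longleftrightarrow> y \<in> e -` basic_open i \<inter> space X"
    have "e x = e y"
    proof (rule ccontr)
      assume "e x \<noteq> e y"
      then obtain U where "open U" "e x \<in> U" "e y \<notin> U" using t1_space by blast
      then obtain n where "e x \<in> basic_open n" "e y \<notin> basic_open n"
        using basic_openE[of U "e x"] by (metis subsetD)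
      then show False using spec[OF xy(3), of n] xy(1,2) by simp
    qed
    then show "x = y" using e xy(1,2) by (simp add: inj_on_def)
  qed
qed

text \<open>After transport to a Polish product, countably many Borel sets on which the projection
  is injective cover the set, by Lusin--Novikov. The theorem of Lusin and Souslin inverts the
  projection on each of them, and the first inverse that gives a valid answer is used.\<close>

theorem countable_section_uniformization:
  fixes P :: "('g::polish_space \<times> 'x) set"
  assumes X: "standard_borel_space X" and P: "P \<in> sets (borel \<Otimes>\<^sub>M X)"
    and count: "\<And>x. x \<in> space X \<Longrightarrow> countable {g. (g, x) \<in> P}"
    and ne: "\<And>x. x \<in> space X \<Longrightarrow> \<exists>g. (g, x) \<in> P"
  obtains \<rho> where "\<rho> \<in> borel_measurable X" "\<And>x. x \<in> space X \<Longrightarrow> (\<rho> x, x) \<in> P"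
proof (cases "space X = {}")
  case True
  then show ?thesis using that[of "\<lambda>_. undefined"] by simp
next
  case False
  then obtain x0 where x0: "x0 \<in> space X" by blast
  obtain e :: "'x \<Rightarrow> nat \<Rightarrow> real"
    where em[measurable]: "e \<in> borel_measurable X" and e: "inj_on e (space X)"
      "\<And>A. A \<in> sets X \<Longrightarrow> e ` A \<in> sets borel"
    by (rule standard_borel_embedding[OF X]) (rule that)
  \<comment> \<open>A left inverse of \<open>e\<close>, made total by the default \<open>x0\<close>;
    it is measurable because \<open>e\<close> maps measurable sets to Borel sets.\<close>
  define i where "i y = (if y \<in> e ` space X then the_inv_into (space X) e y else x0)" for y
  have ie: "i (e x) = x" if "x \<in> space X" for x
    unfolding i_def using that e(1) by (simp add: the_inv_into_f_f)
  have i[measurable]: "i \<in> borel \<rightarrow>\<^sub>M X"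
  proof (rule measurableI)
    show "i y \<in> space X" for y
      by (cases "y \<in> e ` space X") (use ie x0 in \<open>auto simp: i_def\<close>)
    fix A assume A: "A \<in> sets X"
    have "i -` A \<inter> space borel = e ` A \<union> (if x0 \<in> A then - (e ` space X) else {})"
    proof (intro set_eqI)
      fix y
      show "y \<in> i -` A \<inter> space borel \<longleftrightarrow> y \<in> e ` A \<union> (if x0 \<in> A then - (e ` space X) else {})"
      proof (cases "y \<in> e ` space X")
        case True
        then obtain x where x: "x \<in> space X" "y = e x" by blast
        have "y \<in> e ` A \<longleftrightarrow> x \<in> A"
          using x e(1) sets.sets_into_space[OF A] unfolding inj_on_def by blast
        then show ?thesis using ie[OF x(1)] x True by simp
      next
        case False
        then have "y \<notin> e ` A" using sets.sets_into_space[OF A] by blast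
        then show ?thesis using False by (simp add: i_def)
      qed
    qed
    also have "\<dots> \<in> sets borel"
      using e(2)[OF A] e(2)[OF sets.top] by (auto intro: borel_comp)
    finally show "i -` A \<inter> space borel \<in> sets borel" .
  qed
  define P' where "P' = {p. snd p \<in> e ` space X \<and> (fst p, i (snd p)) \<in> P}"
  have P': "P' \<in> sets borel"
  proof -
    have [measurable]: "Measurable.pred (borel \<Otimes>\<^sub>M X) (\<lambda>p. p \<in> P)" using P by simp
    have [measurable]: "Measurable.pred borel (\<lambda>y. y \<in> e ` space X)" using e(2)[OF sets.top] by simp
    have "P' = {p \<in> space (borel \<Otimes>\<^sub>M borel). snd p \<in> e ` space X \<and> (fst p, i (snd p)) \<in> P}"
      unfolding P'_def by (simp add: space_pair_measure)
    also have "\<dots> \<in> sets (borel \<Otimes>\<^sub>M borel)" by measurable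
    finally show ?thesis unfolding borel_prod .
  qed
  have fibres: "countable (P' \<inter> snd -` {y})" for y
  proof (cases "y \<in> e ` space X")
    case True
    then obtain x where x: "x \<in> space X" "y = e x" by blast
    have "P' \<inter> snd -` {y} \<subseteq> (\<lambda>g. (g, y)) ` {g. (g, x) \<in> P}"
      unfolding P'_def using ie[OF x(1)] x(2) by auto
    then show ?thesis using count[OF x(1)] by (meson countable_image countable_subset)
  next
    case False
    then have "P' \<inter> snd -` {y} = {}" unfolding P'_def by auto
    then show ?thesis by simp
  qed
  have csnd: "continuous_on UNIV (snd :: 'g \<times> (nat \<Rightarrow> real) \<Rightarrow> _)"
    by (rule continuous_on_snd[OF continuous_on_id])
  obtain Q :: "nat \<Rightarrow> ('g \<times> (nat \<Rightarrow> real)) set"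
    where Q: "\<And>n. Q n \<in> sets borel" "\<And>n. inj_on snd (Q n)" "P' \<subseteq> (\<Union>n. Q n)"
    by (rule lusin_novikov_cover[OF P' csnd fibres]) (rule that)
  have "\<exists>r \<in> borel_measurable borel. \<forall>z\<in>P' \<inter> Q n. r (snd z) = z" for n
  proof -
    have b: "P' \<inter> Q n \<in> sets borel" using P' Q(1) by (rule sets.Int)
    have inj: "inj_on snd (P' \<inter> Q n)" using Q(2)[of n] by (rule inj_on_subset) blast
    obtain r where "r \<in> borel_measurable borel" "\<And>z. z \<in> P' \<inter> Q n \<Longrightarrow> r (snd z) = z"
      by (rule lusin_souslin[OF b csnd inj]) (rule that)
    then show ?thesis by blast
  qed
  then obtain r :: "nat \<Rightarrow> (nat \<Rightarrow> real) \<Rightarrow> 'g \<times> (nat \<Rightarrow> real)"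
    where r[measurable]: "\<And>n. r n \<in> borel_measurable borel" and r': "\<And>n z. z \<in> P' \<inter> Q n \<Longrightarrow> r n (snd z) = z"
    by metis
  \<comment> \<open>\<open>r n\<close> also takes values over points that are not in the projection
    of \<open>Q n\<close>. Checking the value itself is a Borel condition and does not refer to that
    projection.\<close>
  define good where "good n x \<longleftrightarrow> r n (e x) \<in> P' \<and> snd (r n (e x)) = e x" for n x
  have [measurable]: "Measurable.pred borel (\<lambda>p. p \<in> P')" using P' by simp
  have [measurable]: "(fst :: 'g \<times> (nat \<Rightarrow> real) \<Rightarrow> 'g) \<in> borel \<rightarrow>\<^sub>M borel" "(snd :: 'g \<times> (nat \<Rightarrow> real) \<Rightarrow> _) \<in> borel \<rightarrow>\<^sub>M borel"
    by (intro borel_measurable_continuous_onI continuous_on_fst continuous_on_id csnd)+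
  have [measurable]: "Measurable.pred X (good n)" for n
    unfolding good_def by measurable
  define \<rho> where "\<rho> x = fst (r (LEAST n. good n x) (e x))" for x
  show ?thesis
  proof (rule that)
    show "\<rho> \<in> borel_measurable X"
      unfolding \<rho>_def
    proof (rule measurable_compose_countable)
      show "(\<lambda>x. fst (r n (e x))) \<in> borel_measurable X" for n by measurable
      show "(\<lambda>x. LEAST n. good n x) \<in> X \<rightarrow>\<^sub>M count_space UNIV" by measurable
    qed
    fix x assume x: "x \<in> space X"
    obtain g where "(g, x) \<in> P" using ne[OF x] by blast
    then have g: "(g, e x) \<in> P'" unfolding P'_def using x ie[OF x] by simp
    then obtain n where "(g, e x) \<in> Q n" using Q(3) by blast
    then have "good n x" unfolding good_def using r'[of "(g, e x)" n] g by simp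
    then have "good (LEAST n. good n x) x" by (rule LeastI)
    then have "r (LEAST n. good n x) (e x) \<in> P'" "snd (r (LEAST n. good n x) (e x)) = e x"
      unfolding good_def[of "LEAST n. good n x"] by blast+
    then show "(\<rho> x, x) \<in> P"
      unfolding \<rho>_def P'_def using ie[OF x] by simp
  qed
qed

section \<open>Free actions\<close>

lemma locally_compact_exhaustion:
  assumes "locally_compact_space (euclidean :: 'g::polish_space topology)"
  obtains K :: "nat \<Rightarrow> 'g::polish_space set"
  where "\<And>n. compact (K n)" "incseq K" "(\<Union>n. K n) = UNIV"
proof -
  define J where "J = {n. \<exists>L :: 'g set. compact L \<and> basic_open n \<subseteq> L}"
  have "\<forall>n. \<exists>L :: 'g set. compact L \<and> (n \<in> J \<longrightarrow> basic_open n \<subseteq> L)"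
    unfolding J_def using compact_empty by blast
  from choice[OF this] obtain L :: "nat \<Rightarrow> 'g set"
    where L: "\<forall>n. compact (L n) \<and> (n \<in> J \<longrightarrow> basic_open n \<subseteq> L n)" ..
  have cover: "\<exists>n. x \<in> L n" for x
  proof -
    obtain U C where UC: "open U" "compact C" "x \<in> U" "U \<subseteq> C"
      using assms unfolding locally_compact_space_def by (metis UNIV_I compactin_euclidean_iff open_openin topspace_euclidean)
    obtain n where n: "x \<in> basic_open n" "basic_open n \<subseteq> U"
      using basic_openE[OF UC(1,3)] by blast
    have "n \<in> J" unfolding J_def using n UC by blast
    then show ?thesis using L n by blast
  qed
  show ?thesis
  proof (rule that)
    show "compact (\<Union>i\<le>n. L i)" for n using L by blast
    show "incseq (\<lambda>n. \<Union>i\<le>n. L i)" by (intro incseq_SucI UN_mono) auto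
    show "(\<Union>n. \<Union>i\<le>n. L i) = UNIV" using cover by blast
  qed
qed

text \<open>Finitely many open sets, any two points of which differ by an element of
  \<open>B\<close>, cover \<open>L\<close>; each of them contains at most one point of
  \<open>Z\<close>.\<close>

lemma finite_Int_compact_if_separated:
  fixes Z :: "'g::topological_group_add set"
  assumes B: "open B" "0 \<in> B" and Z: "\<And>g g'. g \<in> Z \<Longrightarrow> g' \<in> Z \<Longrightarrow> g' - g \<in> B \<Longrightarrow> g' = g"
    and L: "compact L"
  shows "finite (Z \<inter> L)"
proof -
  have "\<exists>U. open U \<and> h \<in> U \<and> (\<forall>a\<in>U. \<forall>b\<in>U. a - b \<in> B)" for h
  proof -
    have "open ((\<lambda>q. fst q - snd q) -` B)"
      using B by (intro open_vimage continuous_intros)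
    moreover have "(h, h) \<in> (\<lambda>q. fst q - snd q) -` B" using B by simp
    ultimately obtain U V where UV: "open U" "open V" "(h, h) \<in> U \<times> V" "U \<times> V \<subseteq> (\<lambda>q. fst q - snd q) -` B"
      by (rule open_prod_elim) (rule that)
    have "a - b \<in> B" if "a \<in> U \<inter> V" "b \<in> U \<inter> V" for a b
      using subsetD[OF UV(4), of "(a, b)"] that by simp
    then show ?thesis using UV(1-3) by (intro exI[of _ "U \<inter> V"]) blast
  qed
  then obtain U where U: "\<And>h. open (U h)" "\<And>h. h \<in> U h" "\<And>h a b. a \<in> U h \<Longrightarrow> b \<in> U h \<Longrightarrow> a - b \<in> B"
    by metis
  have cover: "L \<subseteq> (\<Union>h\<in>L. U h)" using U(2) by blast
  obtain F where F: "finite F" "L \<subseteq> (\<Union>h\<in>F. U h)"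
    using compactE_image[OF L _ cover] U(1) by metis
  have "finite (Z \<inter> U h)" for h
  proof (cases "Z \<inter> U h = {}")
    case False
    then obtain g where g: "g \<in> Z" "g \<in> U h" by blast
    have "Z \<inter> U h \<subseteq> {g}" using Z[of g] U(3)[of _ h g] g by blast
    then show ?thesis by (rule finite_subset) simp
  qed simp
  then have "finite (\<Union>h\<in>F. Z \<inter> U h)" using F(1) by blast
  then show ?thesis by (rule finite_subset[rotated]) (use F(2) in blast)
qed

section \<open>Coding sequences of truth values as real numbers\<close>

definition ternary :: "(nat \<Rightarrow> bool) \<Rightarrow> real" where
  "ternary d = (\<Sum>l. if d l then (1/3)^l else 0)"

lemma summable_ternary: "summable (\<lambda>l. if d l then (1/3::real)^l else 0)"
  by (rule summable_comparison_test[OF _ summable_geometric[of "1/3"]]) auto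

text \<open>Base 3 avoids the ambiguity of binary expansions: all digits after position
  \<open>m\<close> contribute at most \<open>(1/3)^m / 2\<close>, less than the digit at
  \<open>m\<close>.\<close>

lemma inj_ternary: "inj ternary"
proof (rule injI, rule ccontr)
  fix c d assume eq: "ternary c = ternary d" and "c \<noteq> d"
  then have "\<exists>l. c l \<noteq> d l" by blast
  define m where "m = (LEAST l. c l \<noteq> d l)"
  have m: "c m \<noteq> d m" unfolding m_def by (rule LeastI_ex) fact
  have less: "c l = d l" if "l < m" for l using not_less_Least[of l] that unfolding m_def by blast
  define t :: "(nat \<Rightarrow> bool) \<Rightarrow> nat \<Rightarrow> real" where "t e l = (if e l then (1/3)^l else 0)" for e l
  have split: "ternary e = (\<Sum>l. t e (l + Suc m)) + (\<Sum>l<m. t e l) + t e m" for e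
    using suminf_split_initial_segment[OF summable_ternary[of e], of "Suc m"]
    unfolding ternary_def t_def[symmetric] by (simp del: add_Suc_right)
  have lower: "0 \<le> (\<Sum>l. t e (l + Suc m))" for e
    unfolding t_def by (intro suminf_nonneg summable_ignore_initial_segment[OF summable_ternary]) auto
  have upper: "(\<Sum>l. t e (l + Suc m)) \<le> (1/3)^m / 2" for e
  proof -
    have s: "(\<lambda>l. (1/3)^Suc m * (1/3::real)^l) sums ((1/3)^Suc m * (1 / (1 - 1/3)))"
      by (intro sums_mult geometric_sums) simp
    have "(\<Sum>l. t e (l + Suc m)) \<le> (\<Sum>l. (1/3)^Suc m * (1/3)^l)"
    proof (rule suminf_le)
      show "t e (l + Suc m) \<le> (1/3)^Suc m * (1/3)^l" for l
        unfolding t_def by (simp add: power_add)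
      show "summable (\<lambda>l. t e (l + Suc m))"
        unfolding t_def by (rule summable_ignore_initial_segment[OF summable_ternary])
      show "summable (\<lambda>l. (1/3)^Suc m * (1/3::real)^l)" using s sums_summable by blast
    qed
    also have "\<dots> = (1/3)^m / 2" using sums_unique[OF s] by simp
    finally show ?thesis .
  qed
  have ts: "(\<Sum>l<m. t c l) = (\<Sum>l<m. t d l)" unfolding t_def using less by (intro sum.cong) auto
  have pos: "(0::real) < (1/3)^m" by simp
  have "t c m = (1/3)^m \<and> t d m = 0 \<or> t c m = 0 \<and> t d m = (1/3)^m"
    using m unfolding t_def by auto
  then show False
    using eq split[of c] split[of d] ts lower[of c] lower[of d] upper[of c] upper[of d] pos by linarith
qed

text \<open>Exceeding a bound is witnessed by finitely many true digits and never by a false one.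
  Digits that hold on open sets therefore give a lower semicontinuous function.\<close>

lemma ternary_gt_iff:
  "ternary d > r \<longleftrightarrow> (\<exists>F. finite F \<and> (\<forall>l\<in>F. d l) \<and> (\<Sum>l\<in>F. (1/3)^l) > r)"
proof
  assume "ternary d > r"
  then have "\<forall>\<^sub>F n in sequentially. (\<Sum>l<n. if d l then (1/3)^l else 0) > r"
    using summable_LIMSEQ[OF summable_ternary[of d]] unfolding ternary_def by (rule order_tendstoD(1)[rotated])
  then obtain n where "(\<Sum>l<n. if d l then (1/3)^l else 0) > r"
    unfolding eventually_sequentially by blast
  moreover have "(\<Sum>l<n. if d l then (1/3::real)^l else 0) = (\<Sum>l\<in>{l\<in>{..<n}. d l}. (1/3)^l)"
    by (rule sum.inter_filter[symmetric]) simp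
  ultimately show "\<exists>F. finite F \<and> (\<forall>l\<in>F. d l) \<and> (\<Sum>l\<in>F. (1/3)^l) > r"
    by (intro exI[of _ "{l\<in>{..<n}. d l}"]) simp
next
  assume "\<exists>F. finite F \<and> (\<forall>l\<in>F. d l) \<and> (\<Sum>l\<in>F. (1/3)^l) > r"
  then obtain F where F: "finite F" "\<forall>l\<in>F. d l" "(\<Sum>l\<in>F. (1/3)^l) > r" by blast
  have "(\<Sum>l\<in>F. (1/3)^l) = (\<Sum>l\<in>F. if d l then (1/3::real)^l else 0)"
    using F(2) by (intro sum.cong) auto
  also have "\<dots> \<le> ternary d"
    unfolding ternary_def by (rule sum_le_suminf[OF summable_ternary F(1)]) auto
  finally show "ternary d > r" using F(3) by linarith
qed

text \<open>Without a minimum the sets \<open>{x. f x > f y}\<close> with \<open>y \<in> S\<close>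
  cover \<open>S\<close>; in a finite subcover the \<open>y\<close> of least value is left
  uncovered.\<close>

lemma lower_semicontinuous_attains_inf:
  fixes f :: "'a::topological_space \<Rightarrow> 'b::linorder"
  assumes S: "compact S" "S \<noteq> {}" and f: "\<And>r. open {x. f x > r}"
  obtains x where "x \<in> S" "\<And>y. y \<in> S \<Longrightarrow> f x \<le> f y"
proof -
  have "\<exists>x\<in>S. \<forall>y\<in>S. f x \<le> f y"
  proof (rule ccontr)
    assume neg: "\<not> ?thesis"
    then have "S \<subseteq> (\<Union>y\<in>S. {x. f x > f y})" by (auto simp: not_le)
    then obtain F where F: "F \<subseteq> S" "finite F" "S \<subseteq> (\<Union>y\<in>F. {x. f x > f y})"
      using compactE_image[OF S(1), of S "\<lambda>y. {x. f x > f y}"] f by blast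
    have "F \<noteq> {}" using F(3) S(2) by blast
    then have "Min (f ` F) \<in> f ` F" using F(2) by (intro Min_in) auto
    then obtain y where y: "y \<in> F" "f y = Min (f ` F)" by auto
    obtain z where "z \<in> F" "f z < f y" using F(1,3) y(1) by blast
    then show False using y(2) F(2) by (metis Min_le finite_imageI imageI leD)
  qed
  then show ?thesis using that by blast
qed

lemma open_measurable_Un:
  assumes "open_measurable X W" "open_measurable X W'"
  shows "open_measurable X (W \<union> W' :: ('g::topological_space \<times> 'x) set)"
proof -
  have "W \<union> W' = (\<Union>b\<in>UNIV. if b then W else W')" by (auto split: if_splits)
  moreover have "open_measurable X (\<Union>b\<in>UNIV. if b then W else W')"
    by (rule open_measurable_countable_UN) (use assms in auto)
  ultimately show ?thesis by simp
qed

section \<open>The two implications for a fixed free action\<close>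

locale free_borel_action =
  fixes X :: "'x measure" and act :: "'g::{topological_group_add, polish_space} \<Rightarrow> 'x \<Rightarrow> 'x"
  assumes lc: "locally_compact_space (euclidean :: 'g topology)"
    and G_space: "borel_G_space X act"
    and free: "free_action X act"
begin

lemma sbs: "standard_borel_space X"
  using G_space unfolding borel_G_space_def by blast

lemma act_measurable: "(\<lambda>p. act (fst p) (snd p)) \<in> borel \<Otimes>\<^sub>M X \<rightarrow>\<^sub>M X"
  using G_space unfolding borel_G_space_def by (simp add: case_prod_unfold)

lemma measurable_act [measurable]:
  assumes "a \<in> M \<rightarrow>\<^sub>M borel" "b \<in> M \<rightarrow>\<^sub>M X"
  shows "(\<lambda>x. act (a x) (b x)) \<in> M \<rightarrow>\<^sub>M X"
  using measurable_compose[OF measurable_Pair[OF assms] act_measurable] by simp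

lemma act_space [simp]: "x \<in> space X \<Longrightarrow> act g x \<in> space X"
  using measurable_space[OF act_measurable, of "(g, x)"] by (simp add: space_pair_measure)

lemma act_zero [simp]: "x \<in> space X \<Longrightarrow> act 0 x = x"
  using G_space unfolding borel_G_space_def by blast

lemma act_act: "x \<in> space X \<Longrightarrow> act g (act h x) = act (g + h) x"
  using G_space unfolding borel_G_space_def by simp

lemma act_eq_iff: "x \<in> space X \<Longrightarrow> act g x = act h x \<longleftrightarrow> g = h"
proof
  assume x: "x \<in> space X" and "act g x = act h x"
  then have "act (- h) (act g x) = act (- h) (act h x)" by simp
  then have "act (- h + g) x = x" using x by (simp add: act_act)
  then have "- h + g = 0" using free x unfolding free_action_def by blast
  then show "g = h" by (metis add.inverse_inverse minus_unique)
qed simp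

lemma orbit_rel_iff: "(x, y) \<in> orbit_rel X act \<longleftrightarrow> x \<in> space X \<and> (\<exists>g. y = act g x)"
  unfolding orbit_rel_def by blast

lemma sectional_hyperfinite_imp_hypercompact:
  assumes "sectional_hyperfinite X act"
  shows "hypercompact X act"
proof -
  obtain C where cs: "cross_section X act C"
    and hf: "hyperfinite (restrict_space X C) (orbit_rel X act \<inter> (C \<times> C))"
    using assms unfolding sectional_hyperfinite_def by blast
  have C: "C \<in> sets X" "\<And>x. x \<in> space X \<Longrightarrow> range (\<lambda>g. act g x) \<inter> C \<noteq> {}"
      "\<And>x. x \<in> space X \<Longrightarrow> countable (range (\<lambda>g. act g x) \<inter> C)"
    using cs unfolding cross_section_def by blast+
  have CX: "C \<subseteq> space X" using C(1) by (rule sets.sets_into_space)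
  have spC: "space (restrict_space X C) = C" using C(1) by simp
  obtain F where F: "incseq F" "\<And>n. F n \<in> sets (restrict_space X C \<Otimes>\<^sub>M restrict_space X C)"
      "\<And>n. equiv C (F n)" "\<And>n x. x \<in> C \<Longrightarrow> finite (F n `` {x})" "orbit_rel X act \<inter> (C \<times> C) = (\<Union>n. F n)"
    using hf unfolding hyperfinite_def borel_equiv_rel_def spC by blast
  obtain K :: "nat \<Rightarrow> 'g set" where K: "\<And>n. compact (K n)" "incseq K" "(\<Union>n. K n) = UNIV"
    by (rule locally_compact_exhaustion[OF lc]) (rule that)
  define P where "P = {p \<in> space (borel \<Otimes>\<^sub>M X). act (fst p) (snd p) \<in> C}"
  have P: "P \<in> sets (borel \<Otimes>\<^sub>M X)"
    unfolding P_def using C(1) by measurable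
  have Pmem: "(g, x) \<in> P \<longleftrightarrow> act g x \<in> C" if "x \<in> space X" for g x
    using that unfolding P_def by (simp add: space_pair_measure)
  have cP: "countable {g. (g, x) \<in> P}" if x: "x \<in> space X" for x
  proof (rule countable_image_inj_on)
    show "countable ((\<lambda>g. act g x) ` {g. (g, x) \<in> P})"
      by (rule countable_subset[OF _ C(3)[OF x]]) (use Pmem[OF x] in blast)
    show "inj_on (\<lambda>g. act g x) {g. (g, x) \<in> P}" using act_eq_iff[OF x] by (simp add: inj_on_def)
  qed
  have neP: "\<exists>g. (g, x) \<in> P" if x: "x \<in> space X" for x
    using C(2)[OF x] Pmem[OF x] by blast
  obtain \<rho> where \<rho>[measurable]: "\<rho> \<in> borel_measurable X" and \<rho>P: "\<And>x. x \<in> space X \<Longrightarrow> (\<rho> x, x) \<in> P"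
    by (rule countable_section_uniformization[OF sbs P])
      (rule cP, assumption, rule neP, assumption, rule that)
  define \<pi> where "\<pi> x = act (\<rho> x) x" for x
  have \<pi>C: "\<pi> x \<in> C" if "x \<in> space X" for x
    using \<rho>P[OF that] Pmem[OF that] unfolding \<pi>_def by blast
  have \<pi>[measurable]: "\<pi> \<in> X \<rightarrow>\<^sub>M restrict_space X C"
  proof (rule measurable_restrict_space2)
    show "\<pi> \<in> space X \<rightarrow> C" using \<pi>C by blast
    show "\<pi> \<in> X \<rightarrow>\<^sub>M X" unfolding \<pi>_def by measurable
  qed
  \<comment> \<open>The diagonal supplies singleton classes for the points with
    \<open>\<rho>\<close> outside \<open>K n\<close>.\<close>
  define E where "E n = {p \<in> space (X \<Otimes>\<^sub>M X). fst p = snd p} \<union>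
    {p \<in> space (X \<Otimes>\<^sub>M X). \<rho> (fst p) \<in> K n \<and> \<rho> (snd p) \<in> K n \<and> (\<pi> (fst p), \<pi> (snd p)) \<in> F n}" for n
  have Emem: "(x, y) \<in> E n \<longleftrightarrow> x \<in> space X \<and> y \<in> space X \<and>
      (x = y \<or> \<rho> x \<in> K n \<and> \<rho> y \<in> K n \<and> (\<pi> x, \<pi> y) \<in> F n)" for x y n
    unfolding E_def by (auto simp: space_pair_measure)
  have E_sets: "E n \<in> sets (X \<Otimes>\<^sub>M X)" for n
  proof -
    have [measurable]: "Measurable.pred (restrict_space X C \<Otimes>\<^sub>M restrict_space X C) (\<lambda>p. p \<in> F n)"
      using F(2) by simp
    have [measurable]: "K n \<in> sets borel" using K(1) by (simp add: borel_compact)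
    have "{p \<in> space (X \<Otimes>\<^sub>M X). \<rho> (fst p) \<in> K n \<and> \<rho> (snd p) \<in> K n \<and> (\<pi> (fst p), \<pi> (snd p)) \<in> F n} \<in> sets (X \<Otimes>\<^sub>M X)"
      by measurable
    then show ?thesis
      unfolding E_def using standard_borel_sets_diagonal[OF sbs] by (rule sets.Un[rotated])
  qed
  have E_equiv: "equiv (space X) (E n)" for n
  proof (rule equivI)
    show "E n \<subseteq> space X \<times> space X" "refl_on (space X) (E n)"
      using Emem unfolding refl_on_def by auto
    show "sym (E n)"
      using Emem[of _ _ n] equivE[OF F(3)[of n]] unfolding sym_def by metis
    show "trans (E n)"
      using Emem[of _ _ n] equivE[OF F(3)[of n]] unfolding trans_def by metis
  qed
  have return_elem: "\<exists>k. c = act k x \<and> g = - \<rho> y + k" if x: "x \<in> space X" and y: "y = act g x" and c: "\<pi> y = c" for x y g c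
  proof (intro exI conjI)
    show "c = act (\<rho> y + g) x" using x y c unfolding \<pi>_def by (simp add: act_act)
    show "g = - \<rho> y + (\<rho> y + g)" by (simp add: add.assoc[symmetric])
  qed
  have orbF: "(\<pi> x, \<pi> y) \<in> orbit_rel X act" if "(\<pi> x, \<pi> y) \<in> F n" for x y n
    using that F(5) by blast
  have E_orbit: "E n \<subseteq> orbit_rel X act" for n
  proof clarify
    fix x y assume "(x, y) \<in> E n"
    then have xy: "x \<in> space X" "y \<in> space X" "x = y \<or> (\<pi> x, \<pi> y) \<in> F n" using Emem by auto
    show "(x, y) \<in> orbit_rel X act"
    proof (cases "x = y")
      case True
      then show ?thesis using xy(1) unfolding orbit_rel_iff by (intro conjI exI[of _ 0]) auto
    next
      case False
      then have "(\<pi> x, \<pi> y) \<in> orbit_rel X act" using xy(3) orbF by blast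
      then obtain h where "act (\<rho> y) y = act h (act (\<rho> x) x)" unfolding orbit_rel_iff \<pi>_def by blast
      then have "act (- \<rho> y) (act (\<rho> y) y) = act (- \<rho> y) (act h (act (\<rho> x) x))" by simp
      then have "y = act (- \<rho> y + (h + \<rho> x)) x" using xy(1,2) by (simp add: act_act)
      then show ?thesis unfolding orbit_rel_iff using xy(1) by blast
    qed
  qed
  have E_compact: "compact (closure (return_set act (E n) x))" if x: "x \<in> space X" for n x
  proof -
    have "\<exists>k. c = act k x" if "c \<in> F n `` {\<pi> x}" for c
    proof -
      have "(\<pi> x, c) \<in> orbit_rel X act" using that F(5) by blast
      then show ?thesis using x unfolding orbit_rel_iff \<pi>_def by (auto simp: act_act)
    qed
    then obtain k where k: "\<And>c. c \<in> F n `` {\<pi> x} \<Longrightarrow> c = act (k c) x" by metis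
    \<comment> \<open>A return element \<open>g\<close> equals
      \<open>- \<rho> (act g x) + k c\<close> for \<open>c = \<pi> (act g x)\<close>. Here
      \<open>\<rho> (act g x)\<close> is in \<open>K n\<close>, \<open>c\<close> is in the finite
      \<open>F n\<close>-class of \<open>\<pi> x\<close>, and freeness makes \<open>k c\<close> the
      only element taking \<open>x\<close> to \<open>c\<close>. The \<open>0\<close> accounts for
      the diagonal.\<close>
    define L where "L = {0} \<union> (\<Union>c\<in>F n `` {\<pi> x}. (\<lambda>a. - a + k c) ` K n)"
    have "compact L"
      unfolding L_def using F(4)[OF \<pi>C[OF x], of n] K(1)
      by (intro compact_Un compact_UN compact_continuous_image continuous_intros) auto
    moreover have "return_set act (E n) x \<subseteq> L"
    proof
      fix g assume "g \<in> return_set act (E n) x"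
      then have g: "x = act g x \<or> \<rho> (act g x) \<in> K n \<and> (\<pi> x, \<pi> (act g x)) \<in> F n"
        unfolding return_set_def Emem by blast
      show "g \<in> L"
      proof (cases "g = 0")
        case False
        then have "act g x \<noteq> x" using free x unfolding free_action_def by blast
        then have g': "\<rho> (act g x) \<in> K n" "\<pi> (act g x) \<in> F n `` {\<pi> x}" using g by auto
        obtain k' where k': "\<pi> (act g x) = act k' x" "g = - \<rho> (act g x) + k'"
          using return_elem[OF x refl refl] by blast
        have "k' = k (\<pi> (act g x))" using k[OF g'(2)] k'(1) act_eq_iff[OF x] by metis
        then have "g = - \<rho> (act g x) + k (\<pi> (act g x))" using k'(2) by simp
        then show ?thesis unfolding L_def using g' by blast
      qed (simp add: L_def)
    qed
    ultimately show ?thesis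
      by (metis closure_minimal closed_closure compact_Int_closed compact_imp_closed inf.absorb_iff2)
  qed
  show ?thesis
    unfolding hypercompact_def compact_filtration_def compact_OER_def OER_def borel_equiv_rel_def
  proof (intro exI[of _ E] conjI allI ballI)
    show "incseq E"
    proof (rule incseq_SucI, rule subrelI)
      fix n x y assume "(x, y) \<in> E n"
      then show "(x, y) \<in> E (Suc n)"
        using incseq_SucD[OF F(1), of n] incseq_SucD[OF K(2), of n] unfolding Emem by blast
    qed
    show "orbit_rel X act = (\<Union>n. E n)"
    proof
      show "orbit_rel X act \<subseteq> (\<Union>n. E n)"
      proof (rule subrelI)
        fix x y assume "(x, y) \<in> orbit_rel X act"
        then obtain g where x: "x \<in> space X" and g: "y = act g x" unfolding orbit_rel_iff by blast
        then have y: "y \<in> space X" by simp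
        have "\<pi> y = act (\<rho> y + g + - \<rho> x) (\<pi> x)"
          unfolding \<pi>_def g using x by (simp add: act_act add.assoc)
        then have "(\<pi> x, \<pi> y) \<in> orbit_rel X act"
          unfolding orbit_rel_iff using \<pi>C[OF x] CX by blast
        then obtain n1 where n1: "(\<pi> x, \<pi> y) \<in> F n1" using F(5) \<pi>C[OF x] \<pi>C[OF y] by blast
        obtain n2 where n2: "\<rho> x \<in> K n2" using K(3) by blast
        obtain n3 where n3: "\<rho> y \<in> K n3" using K(3) by blast
        define n where "n = max n1 (max n2 n3)"
        have "F n1 \<subseteq> F n" "K n2 \<subseteq> K n" "K n3 \<subseteq> K n"
          using F(1) K(2) unfolding incseq_def n_def by auto
        then have "(x, y) \<in> E n" unfolding Emem using x y n1 n2 n3 by blast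
        then show "(x, y) \<in> (\<Union>n. E n)" by blast
      qed
    qed (use E_orbit in blast)
  qed (use E_sets E_equiv E_orbit E_compact in auto)
qed

text \<open>The sets \<open>{x. act g x \<in> A for nonmeagerly many g \<in> U}\<close> with \<open>A\<close> from a separating sequence and
  \<open>U\<close> basic open pull back to open sets along orbits and still separate points.\<close>

lemma orbit_lower_semicontinuous_injection:
  obtains f :: "'x \<Rightarrow> real"
  where "f \<in> borel_measurable X" "inj_on f (space X)"
    "\<And>r. open_measurable X {(h, x). x \<in> space X \<and> f (act h x) > r}"
proof -
  obtain A :: "nat \<Rightarrow> 'x set" where A: "\<And>i. A i \<in> sets X"
      "\<And>x y. x \<in> space X \<Longrightarrow> y \<in> space X \<Longrightarrow> \<forall>i. x \<in> A i \<longleftrightarrow> y \<in> A i \<Longrightarrow> x = y"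
    by (rule standard_borel_separating_sequence[OF sbs]) (rule that)
  \<comment> \<open>A Vaught transform of a separating set; \<open>l\<close> codes the pair of the
    basic open set and the separating set.\<close>
  define v where "v x l \<longleftrightarrow> \<not> meager (basic_open (fst (prod_decode l)) \<inter> {g. act g x \<in> A (snd (prod_decode l))})" for x l
  define f where "f x = ternary (v x)" for x
  have v_om: "open_measurable X {(h, x). x \<in> space X \<and> v (act h x) l}" for l
  proof -
    let ?U = "basic_open (fst (prod_decode l)) :: 'g set" and ?A = "A (snd (prod_decode l))"
    define M where "M = {p \<in> space (borel \<Otimes>\<^sub>M X). act (fst p) (snd p) \<in> ?A}"
    have M: "M \<in> sets (borel \<Otimes>\<^sub>M X)" unfolding M_def using A(1) by measurable
    have "v (act h x) l \<longleftrightarrow> \<not> meager ({g. g - h \<in> ?U} \<inter> {g. (g, x) \<in> M})" if "x \<in> space X" for h x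
    proof -
      have "meager ({g. g - h \<in> ?U} \<inter> {g. (g, x) \<in> M}) \<longleftrightarrow>
          meager {g. g + h \<in> {g. g - h \<in> ?U} \<inter> {g. (g, x) \<in> M}}"
        by (simp only: meager_translate_iff)
      also have "{g. g + h \<in> {g. g - h \<in> ?U} \<inter> {g. (g, x) \<in> M}} = ?U \<inter> {g. act g (act h x) \<in> ?A}"
        using that by (auto simp: M_def space_pair_measure act_act)
      finally show ?thesis unfolding v_def by blast
    qed
    then have "{(h, x). x \<in> space X \<and> v (act h x) l} =
        {(h, x). x \<in> space X \<and> \<not> meager ({g. g - h \<in> ?U} \<inter> {g. (g, x) \<in> M})}" by blast
    then show ?thesis using open_measurable_nonmeager_translate[OF M, of ?U] by simp
  qed
  have om: "open_measurable X {(h, x). x \<in> space X \<and> f (act h x) > r}" for r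
  proof -
    define \<F> where "\<F> = {F. finite F \<and> (\<Sum>l\<in>F. (1/3::real)^l) > r}"
    have "\<F> \<subseteq> Collect finite" unfolding \<F>_def by blast
    then have c: "countable \<F>" using countable_Collect_finite countable_subset by blast
    have "{(h, x). x \<in> space X \<and> f (act h x) > r} =
        (\<Union>F\<in>\<F>. UNIV \<times> space X \<inter> (\<Inter>l\<in>F. {(h, x). x \<in> space X \<and> v (act h x) l}))"
      unfolding f_def ternary_gt_iff \<F>_def by auto
    moreover have "open_measurable X (\<Union>F\<in>\<F>. UNIV \<times> space X \<inter> (\<Inter>l\<in>F. {(h, x). x \<in> space X \<and> v (act h x) l}))"
      by (rule open_measurable_countable_UN[OF c], rule open_measurable_finite_INT)
        (use v_om in \<open>auto simp: \<F>_def\<close>)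
    ultimately show ?thesis by (simp only:)
  qed
  show ?thesis
  proof (rule that)
    show "open_measurable X {(h, x). x \<in> space X \<and> f (act h x) > r}" for r by (rule om)
    show "f \<in> borel_measurable X"
    proof (rule borel_measurable_iff_greater[THEN iffD2], rule allI)
      fix r
      have eq: "{x \<in> space X. r < f x} = Pair (0 :: 'g) -` {(h, x). x \<in> space X \<and> f (act h x) > r}"
        by auto
      show "{x \<in> space X. r < f x} \<in> sets X"
        unfolding eq by (rule sets_Pair1[OF sets_open_measurable[OF om]])
    qed
    show "inj_on f (space X)"
    proof (rule inj_onI)
      fix x y assume xy: "x \<in> space X" "y \<in> space X" "f x = f y"
      have vxy: "v x = v y" using xy(3) inj_ternary unfolding f_def by (rule injD[rotated])
      define D where "D x i = {g. act g x \<in> A i}" for x i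
      have Db: "D x i \<in> sets borel" if "x \<in> space X" for x i
      proof -
        have "(\<lambda>g. act g x) \<in> borel \<rightarrow>\<^sub>M X" using that by measurable
        from measurable_sets[OF this A(1)] show ?thesis unfolding D_def by (simp add: vimage_def)
      qed
      \<comment> \<open>If the difference were comeager in a nonempty basic open set, the digit for
        this set and \<open>A i\<close> would be false at \<open>y\<close>, hence at
        \<open>x\<close>, although \<open>D x i\<close> is comeager there.\<close>
      have half: "meager (D x i - D y i)" if x: "x \<in> space X" and y: "y \<in> space X" and eq: "v x = v y" for x y i
      proof (rule ccontr)
        assume nm: "\<not> meager (D x i - D y i)"
        have b: "D x i - D y i \<in> sets borel" using Db[OF x] Db[OF y] by blast
        have nm': "\<not> meager (UNIV \<inter> (D x i - D y i))" using nm by simp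
        obtain n where n: "basic_open n \<noteq> ({} :: 'g set)" "meager (basic_open n - (D x i - D y i))"
          by (rule nonmeager_borel_localization[OF b open_UNIV nm']) (rule that)
        have "\<not> v y (prod_encode (n, i))"
          unfolding v_def using meager_subset[OF n(2), of "basic_open n \<inter> {g. act g y \<in> A i}"]
          by (auto simp: D_def)
        then have "meager (basic_open n \<inter> D x i)" unfolding eq[symmetric] v_def D_def by simp
        from meager_Un[OF this n(2)] have "meager (basic_open n :: 'g set)"
          by (rule meager_subset) blast
        then show False using open_not_meager[OF open_basic_open n(1)] by blast
      qed
      \<comment> \<open>So some single \<open>g\<close> moves \<open>x\<close> and \<open>y\<close>
        to points that no \<open>A i\<close> distinguishes.\<close>
      have "meager (\<Union>i. (D x i - D y i) \<union> (D y i - D x i))"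
        using half[OF xy(1,2) vxy] half[OF xy(2,1) vxy[symmetric]] by (intro meager_UN meager_Un)
      then have "(\<Union>i. (D x i - D y i) \<union> (D y i - D x i)) \<noteq> UNIV"
        using open_not_meager[OF open_UNIV UNIV_not_empty, where 'a = 'g] by metis
      then obtain g where "g \<notin> (\<Union>i. (D x i - D y i) \<union> (D y i - D x i))" by blast
      then have "act g x \<in> A i \<longleftrightarrow> act g y \<in> A i" for i unfolding D_def by blast
      then have "act g x = act g y" using A(2) xy(1,2) by simp
      then have "act (- g) (act g x) = act (- g) (act g y)" by simp
      then show "x = y" using xy(1,2) by (simp add: act_act)
    qed
  qed
qed

text \<open>\<open>S x\<close> is the set of \<open>h\<close> such that the \<open>E\<close>-class of \<open>x\<close> is comeager in \<open>B + h\<close>. It is compact and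
  transforms equivariantly within the class, so the minimum over it of an orbitwise lower
  semicontinuous injection selects one point for each class with \<open>S x \<noteq> {}\<close>. Distinct selected points
  \<open>y\<close> belong to distinct classes, each comeager in the translate of \<open>B\<close> at \<open>y\<close>, hence are separated.\<close>

lemma lacunary_selection:
  assumes E: "compact_OER X act E" and B: "open B" "0 \<in> B"
  obtains C where "C \<in> sets X" "\<And>y v. y \<in> C \<Longrightarrow> act v y \<in> C \<Longrightarrow> v \<in> B \<Longrightarrow> v = 0"
    "\<And>x h. x \<in> space X \<Longrightarrow> meager ({g. g - h \<in> B} - return_set act E x) \<Longrightarrow> \<exists>h. act h x \<in> C"
proof -
  obtain f :: "'x \<Rightarrow> real" where f[measurable]: "f \<in> borel_measurable X" and finj: "inj_on f (space X)"
    and fom: "\<And>r. open_measurable X {(h, x). x \<in> space X \<and> f (act h x) > r}"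
    by (rule orbit_lower_semicontinuous_injection) (rule that)
  obtain K :: "nat \<Rightarrow> 'g set" where K: "\<And>n. compact (K n)" "incseq K" "(\<Union>n. K n) = UNIV"
    by (rule locally_compact_exhaustion[OF lc]) (rule that)
  have Es: "E \<in> sets (X \<Otimes>\<^sub>M X)" and Eeq: "equiv (space X) E" and Eorb: "E \<subseteq> orbit_rel X act"
    and Ec: "\<And>x. x \<in> space X \<Longrightarrow> compact (closure (return_set act E x))"
    using E unfolding compact_OER_def OER_def borel_equiv_rel_def by blast+
  have Esym: "(x, y) \<in> E \<Longrightarrow> (y, x) \<in> E" and Etrans: "(x, y) \<in> E \<Longrightarrow> (y, z) \<in> E \<Longrightarrow> (x, z) \<in> E" for x y z
    using Eeq unfolding equiv_def sym_def trans_def by blast+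
  define S where "S x = {h. meager {g. g - h \<in> B \<and> (x, act g x) \<notin> E}}" for x
  define M where "M = {p \<in> space (borel \<Otimes>\<^sub>M X). (snd p, act (fst p) (snd p)) \<notin> E}"
  have [measurable]: "Measurable.pred (X \<Otimes>\<^sub>M X) (\<lambda>p. p \<in> E)" using Es by simp
  have M: "M \<in> sets (borel \<Otimes>\<^sub>M X)" unfolding M_def by measurable
  define W where "W = {(h, x). x \<in> space X \<and> h \<notin> S x}"
  have W: "open_measurable X W"
  proof -
    have "W = {(h, x). x \<in> space X \<and> \<not> meager ({g. g - h \<in> B} \<inter> {g. (g, x) \<in> M})}"
      unfolding W_def S_def M_def by (auto simp: space_pair_measure Int_def)
    then show ?thesis using open_measurable_nonmeager_translate[OF M B(1)] by simp
  qed
  have S_closed: "closed (S x)" if "x \<in> space X" for x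
  proof -
    have "{g. (g, x) \<in> W} = - S x" using that unfolding W_def by blast
    then show ?thesis using open_section_open_measurable[OF W, of x] by (simp add: open_closed)
  qed
  \<comment> \<open>Since \<open>0 \<in> B\<close>, the translate of \<open>B\<close> at
    \<open>h\<close> is a neighbourhood of \<open>h\<close>; for \<open>h\<close> outside the
    closure, a nonempty open part of it would miss the class.\<close>
  have S_sub: "S x \<subseteq> closure (return_set act E x)" for x
  proof
    fix h assume h: "h \<in> S x"
    show "h \<in> closure (return_set act E x)"
    proof (rule ccontr)
      assume "h \<notin> closure (return_set act E x)"
      then have hc: "h \<in> - closure (return_set act E x)" by blast
      have o1: "open {g. g - h \<in> B}"
        by (rule open_translate[OF B(1)])
      have o: "open ({g. g - h \<in> B} \<inter> - closure (return_set act E x))"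
        using o1 by (intro open_Int open_Compl closed_closure)
      have "h \<in> {g. g - h \<in> B} \<inter> - closure (return_set act E x)" using hc B(2) by simp
      then have "\<not> meager ({g. g - h \<in> B} \<inter> - closure (return_set act E x))"
        using open_not_meager[OF o] by blast
      moreover have "{g. g - h \<in> B} \<inter> - closure (return_set act E x) \<subseteq> {g. g - h \<in> B \<and> (x, act g x) \<notin> E}"
        using closure_subset[of "return_set act E x"] unfolding return_set_def by blast
      ultimately show False using h meager_subset unfolding S_def by blast
    qed
  qed
  have S_compact: "compact (S x)" if "x \<in> space X" for x
    using compact_Int_closed[OF Ec[OF that] S_closed[OF that]] S_sub[of x] by (simp add: Int_absorb1)
  have S_act: "k \<in> S (act u x) \<longleftrightarrow> k + u \<in> S x" if x: "x \<in> space X" and xu: "(x, act u x) \<in> E" for k u x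
  proof -
    have "(act u x, act g (act u x)) \<in> E \<longleftrightarrow> (x, act (g + u) x) \<in> E" for g
      unfolding act_act[OF x] using Esym[OF xu] Etrans xu by blast
    then have eq: "{g. g - k \<in> B \<and> (act u x, act g (act u x)) \<notin> E} =
        {g. g + u \<in> {g. g - (k + u) \<in> B \<and> (x, act g x) \<notin> E}}"
      by (simp add: add_diff_add_right_cancel)
    show ?thesis
      using meager_translate_iff[of u "{g. g - (k + u) \<in> B \<and> (x, act g x) \<notin> E}", folded eq]
      unfolding S_def by blast
  qed
  \<comment> \<open>The quantifier over \<open>h\<close> is an uncountable projection. Both
    conditions on \<open>h\<close> have open measurable complements and \<open>G\<close> is a
    countable union of compact sets, which keeps \<open>D r\<close> Borel.\<close>
  define D where "D r = {x \<in> space X. \<exists>h\<in>S x. f (act h x) \<le> r}" for r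
  have D: "D r \<in> sets X" for r
  proof -
    have om: "open_measurable X (W \<union> {(h, x). x \<in> space X \<and> f (act h x) > r})"
      by (rule open_measurable_Un[OF W fom])
    have "D r = (\<Union>j. space X - {x \<in> space X. K j \<subseteq> {h. (h, x) \<in> W \<union> {(h, x). x \<in> space X \<and> f (act h x) > r}}})"
    proof (intro equalityI subsetI)
      fix x assume "x \<in> D r"
      then obtain h where h: "x \<in> space X" "h \<in> S x" "f (act h x) \<le> r" unfolding D_def by blast
      obtain j where j: "h \<in> K j" using K(3) by blast
      have "(h, x) \<notin> W \<union> {(h, x). x \<in> space X \<and> f (act h x) > r}"
        using h unfolding W_def by simp
      then show "x \<in> (\<Union>j. space X - {x \<in> space X. K j \<subseteq> {h. (h, x) \<in> W \<union> {(h, x). x \<in> space X \<and> f (act h x) > r}}})"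
        using h(1) j by blast
    next
      fix x assume "x \<in> (\<Union>j. space X - {x \<in> space X. K j \<subseteq> {h. (h, x) \<in> W \<union> {(h, x). x \<in> space X \<and> f (act h x) > r}}})"
      then obtain h where "x \<in> space X" "(h, x) \<notin> W \<union> {(h, x). x \<in> space X \<and> f (act h x) > r}" by blast
      then show "x \<in> D r" unfolding D_def W_def by (auto simp: not_less)
    qed
    also have "\<dots> \<in> sets X"
      using sets_compact_subset_section[OF om K(1)] by (intro sets.countable_UN) auto
    finally show ?thesis .
  qed
  \<comment> \<open>A pair \<open>(g, y)\<close> is in \<open>N\<close> iff \<open>y\<close> is the
    point selected by the class of \<open>act g y\<close>: as
    \<open>y = act (- g) (act g y)\<close>, this needs \<open>- g \<in> S (act g y)\<close> and no
    smaller value of \<open>f\<close>. Rational bounds express the latter by the Borel sets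
    \<open>D r\<close>.\<close>
  define N where "N = {p \<in> space (borel \<Otimes>\<^sub>M X). (- fst p, act (fst p) (snd p)) \<notin> W \<and>
      (\<forall>r\<in>\<rat>. r < f (snd p) \<longrightarrow> act (fst p) (snd p) \<notin> D r)}"
  have N: "N \<in> sets (borel \<Otimes>\<^sub>M X)"
  proof -
    have [measurable]: "Measurable.pred (borel \<Otimes>\<^sub>M X) (\<lambda>p. p \<in> W)" using sets_open_measurable[OF W] by simp
    have [measurable]: "Measurable.pred X (\<lambda>x. x \<in> D r)" for r using D by simp
    have [measurable]: "(uminus :: 'g \<Rightarrow> 'g) \<in> borel \<rightarrow>\<^sub>M borel"
      by (intro borel_measurable_continuous_onI continuous_intros)
    have q: "(\<forall>r\<in>\<rat>. r < f (snd p) \<longrightarrow> act (fst p) (snd p) \<notin> D r) \<longleftrightarrow>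
        (\<forall>r :: rat. of_rat r < f (snd p) \<longrightarrow> act (fst p) (snd p) \<notin> D (of_rat r))" for p :: "'g \<times> 'x"
      unfolding Rats_def by simp
    show ?thesis unfolding N_def q by measurable
  qed
  have N_iff: "(g, y) \<in> N \<longleftrightarrow> - g \<in> S (act g y) \<and> (\<forall>h\<in>S (act g y). f y \<le> f (act h (act g y)))"
    if y: "y \<in> space X" for g y
  proof -
    have "(\<forall>r\<in>\<rat>. r < f y \<longrightarrow> act g y \<notin> D r) \<longleftrightarrow> (\<forall>h\<in>S (act g y). f y \<le> f (act h (act g y)))"
    proof
      assume L: "\<forall>r\<in>\<rat>. r < f y \<longrightarrow> act g y \<notin> D r"
      show "\<forall>h\<in>S (act g y). f y \<le> f (act h (act g y))"
      proof (rule ballI, rule ccontr)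
        fix h assume h: "h \<in> S (act g y)" "\<not> f y \<le> f (act h (act g y))"
        then obtain r where "r \<in> \<rat>" "f (act h (act g y)) < r" "r < f y"
          using Rats_dense_in_real[of "f (act h (act g y))" "f y"] by auto
        then show False using L h(1) y unfolding D_def by force
      qed
    next
      assume R: "\<forall>h\<in>S (act g y). f y \<le> f (act h (act g y))"
      show "\<forall>r\<in>\<rat>. r < f y \<longrightarrow> act g y \<notin> D r"
        using R unfolding D_def by fastforce
    qed
    then show ?thesis
      using y unfolding N_def W_def by (simp add: space_pair_measure)
  qed
  \<comment> \<open>A selected \<open>y\<close> may lie outside the class that selects it, so the
    class is sought at \<open>act g y\<close> for \<open>g \<in> B\<close>. Requiring nonmeagerly
    many such \<open>g\<close> instead of one avoids a projection and keeps \<open>C\<close>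
    Borel.\<close>
  define C where "C = {y \<in> space X. \<not> meager (B \<inter> {g. (g, y) \<in> N})}"
  have C_elim: "\<exists>x h. x \<in> space X \<and> h \<in> S x \<and> y = act h x \<and> (\<forall>h'\<in>S x. f y \<le> f (act h' x))"
    if "y \<in> C" for y
  proof -
    have y: "y \<in> space X" "\<not> meager (B \<inter> {g. (g, y) \<in> N})" using that unfolding C_def by blast+
    then have "B \<inter> {g. (g, y) \<in> N} \<noteq> {}" by force
    then obtain g where "(g, y) \<in> N" by blast
    then have "- g \<in> S (act g y)" "\<forall>h\<in>S (act g y). f y \<le> f (act h (act g y))"
      using N_iff[OF y(1)] by blast+
    moreover have "y = act (- g) (act g y)" using y(1) by (simp add: act_act)
    ultimately show ?thesis using y(1) by (intro exI[of _ "act g y"] exI[of _ "- g"]) simp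
  qed
  have near: "meager (B \<inter> {g. (x, act (g + h) x) \<notin> E})" if "h \<in> S x" for x h
  proof -
    have eq: "B \<inter> {g. (x, act (g + h) x) \<notin> E} = {g. g + h \<in> {g. g - h \<in> B \<and> (x, act g x) \<notin> E}}"
      by auto
    show ?thesis
      using that meager_translate_iff[of h "{g. g - h \<in> B \<and> (x, act g x) \<notin> E}", folded eq]
      unfolding S_def by blast
  qed
  show ?thesis
  proof (rule that)
    show "C \<in> sets X" unfolding C_def by (rule sets_nonmeager_section[OF N B(1)])
    fix y v assume yC: "y \<in> C" and vC: "act v y \<in> C" and v: "v \<in> B"
    obtain x h where x: "x \<in> space X" "h \<in> S x" "y = act h x" "\<forall>h'\<in>S x. f y \<le> f (act h' x)"
      using C_elim[OF yC] by blast
    obtain x' h' where x': "x' \<in> space X" "h' \<in> S x'" "act v y = act h' x'" "\<forall>h\<in>S x'. f (act v y) \<le> f (act h x')"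
      using C_elim[OF vC] by blast
    have y: "y \<in> space X" using x by simp
    have n1: "meager (B \<inter> {g. (x, act g y) \<notin> E})"
      using near[OF x(2)] x(1,3) by (simp add: act_act)
    have "meager (B \<inter> {g. (x', act g (act v y)) \<notin> E})"
      using near[OF x'(2)] x'(1,3) by (simp add: act_act)
    then have "meager {g. g + - v \<in> B \<inter> {g. (x', act g (act v y)) \<notin> E}}"
      by (simp only: meager_translate_iff)
    moreover have "{g. g + - v \<in> B \<inter> {g. (x', act g (act v y)) \<notin> E}} = {g. g - v \<in> B} \<inter> {g. (x', act g y) \<notin> E}"
      using y by (auto simp: act_act add.assoc)
    ultimately have n2: "meager ({g. g - v \<in> B} \<inter> {g. (x', act g y) \<notin> E})" by simp
    \<comment> \<open>Seen from \<open>y\<close>, the class of \<open>x\<close> is comeager in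
      \<open>B\<close> and that of \<open>x'\<close> in the translate of \<open>B\<close> at
      \<open>v\<close>. Both open sets contain \<open>v\<close>, because \<open>v \<in> B\<close>
      and \<open>0 \<in> B\<close>, so the two classes meet.\<close>
    have "open (B \<inter> {g. g - v \<in> B})"
      using B(1) by (intro open_Int open_translate)
    moreover have "v \<in> B \<inter> {g. g - v \<in> B}" using v B(2) by simp
    ultimately have nm: "\<not> meager (B \<inter> {g. g - v \<in> B})" using open_not_meager by blast
    have m: "meager ((B \<inter> {g. (x, act g y) \<notin> E}) \<union> ({g. g - v \<in> B} \<inter> {g. (x', act g y) \<notin> E}))"
      using n1 n2 by (rule meager_Un)
    obtain g where "(x, act g y) \<in> E" "(x', act g y) \<in> E"
    proof (rule ccontr)
      assume "\<not> thesis"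
      then have "B \<inter> {g. g - v \<in> B} \<subseteq>
          (B \<inter> {g. (x, act g y) \<notin> E}) \<union> ({g. g - v \<in> B} \<inter> {g. (x', act g y) \<notin> E})"
        using that by blast
      then show False using nm meager_subset[OF m] by blast
    qed
    then have xx': "(x, x') \<in> E" using Esym Etrans by blast
    then obtain u where u: "x' = act u x" using Eorb unfolding orbit_rel_def by blast
    have "h' + u \<in> S x" using S_act[OF x(1), of u h'] xx' x'(2) unfolding u by blast
    \<comment> \<open>Now \<open>y\<close> and \<open>act v y\<close> both minimize \<open>f\<close>
      over the same set of points, since \<open>S\<close> is equivariant within the class.\<close>
    then have le1: "f y \<le> f (act v y)" using x(1,4) x'(3) u by (simp add: act_act)
    have "h - u \<in> S x'" using S_act[OF x(1), of u "h - u"] xx' x(2) unfolding u by simp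
    then have "f (act v y) \<le> f (act (h - u) x')" using x'(4) by blast
    also have "act (h - u) x' = y" using u x(1,3) by (simp add: act_act)
    finally have "f (act v y) = f y" using le1 by simp
    then have "act v y = y" using finj y by (simp add: inj_on_def)
    then show "v = 0" using free y unfolding free_action_def by blast
  next
    fix x h assume x: "x \<in> space X" and "meager ({g. g - h \<in> B} - return_set act E x)"
    then have "meager {g. g - h \<in> B \<and> (x, act g x) \<notin> E}"
      by (elim meager_subset) (auto simp: return_set_def)
    then have ne: "S x \<noteq> {}" unfolding S_def by blast
    have fo: "open {h. f (act h x) > r}" for r
      using open_section_open_measurable[OF fom[of r], of x] x by simp
    obtain k where k: "k \<in> S x" "\<And>h'. h' \<in> S x \<Longrightarrow> f (act k x) \<le> f (act h' x)"
      by (rule lower_semicontinuous_attains_inf[OF S_compact[OF x] ne fo]) (rule that)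
    define y where "y = act k x"
    have y: "y \<in> space X" unfolding y_def using x by simp
    \<comment> \<open>Every point of the class selects the same \<open>y\<close>, and the class is
      comeager in \<open>B\<close> as seen from \<open>y\<close> because
      \<open>k \<in> S x\<close>.\<close>
    have "B \<inter> {g. (x, act (g + k) x) \<in> E} \<subseteq> B \<inter> {g. (g, y) \<in> N}"
    proof (intro subsetI IntI CollectI)
      fix g assume g: "g \<in> B \<inter> {g. (x, act (g + k) x) \<in> E}"
      then have xg: "(x, act (g + k) x) \<in> E" by blast
      have gy: "act g y = act (g + k) x" unfolding y_def using x by (simp add: act_act)
      have "- g + (g + k) = k" by (simp add: add.assoc[symmetric])
      then have "- g \<in> S (act g y)" unfolding gy S_act[OF x xg] using k(1) by simp
      moreover have "f y \<le> f (act h (act g y))" if "h \<in> S (act g y)" for h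
        using that k(2)[of "h + (g + k)"] x unfolding gy S_act[OF x xg]
          unfolding y_def by (simp add: act_act)
      ultimately show "(g, y) \<in> N" using N_iff[OF y] by blast
    qed blast
    moreover have "\<not> meager (B \<inter> {g. (x, act (g + k) x) \<in> E})"
    proof
      assume "meager (B \<inter> {g. (x, act (g + k) x) \<in> E})"
      from meager_Un[OF this near[OF k(1)]] have "meager B" by (rule meager_subset) blast
      then show False using open_not_meager[OF B(1)] B(2) by blast
    qed
    ultimately have "y \<in> C" unfolding C_def using y meager_subset by blast
    then show "\<exists>h. act h x \<in> C" unfolding y_def by blast
  qed
qed

lemma hypercompact_imp_sectional_hyperfinite:
  assumes "hypercompact X act"
  shows "sectional_hyperfinite X act"
proof -
  obtain E where E: "incseq E" "\<And>n. compact_OER X act (E n)" "orbit_rel X act = (\<Union>n. E n)"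
    using assms unfolding hypercompact_def compact_filtration_def by blast
  have Es: "E n \<in> sets (X \<Otimes>\<^sub>M X)" and Eeq: "equiv (space X) (E n)"
    and Ec: "\<And>x. x \<in> space X \<Longrightarrow> compact (closure (return_set act (E n) x))" for n
    using E(2)[of n] unfolding compact_OER_def OER_def borel_equiv_rel_def by blast+
  obtain K :: "nat \<Rightarrow> 'g set" where K: "\<And>n. compact (K n)" "incseq K" "(\<Union>n. K n) = UNIV"
    by (rule locally_compact_exhaustion[OF lc]) (rule that)
  \<comment> \<open>The balls serve only as a countable neighbourhood base at \<open>0\<close>;
    invariance of the metric is not assumed.\<close>
  define B :: "nat \<Rightarrow> 'g set" where "B k = ball 0 (1 / Suc k)" for k
  have B: "open (B k)" "0 \<in> B k" for k unfolding B_def by auto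
  define sel where "sel n k C \<longleftrightarrow> C \<in> sets X \<and> (\<forall>y v. y \<in> C \<longrightarrow> act v y \<in> C \<longrightarrow> v \<in> B k \<longrightarrow> v = 0) \<and>
      (\<forall>x h. x \<in> space X \<longrightarrow> meager ({g. g - h \<in> B k} - return_set act (E n) x) \<longrightarrow> (\<exists>h. act h x \<in> C))" for n k C
  have sel: "\<exists>C. sel n k C" for n k
    unfolding sel_def by (rule lacunary_selection[OF E(2)[of n] B[of k]]) blast
  define C where "C n k = (SOME C. sel n k C)" for n k
  have "sel n k (C n k)" for n k unfolding C_def by (rule someI_ex[OF sel])
  then have C: "\<And>n k. C n k \<in> sets X"
      "\<And>n k y v. y \<in> C n k \<Longrightarrow> act v y \<in> C n k \<Longrightarrow> v \<in> B k \<Longrightarrow> v = 0"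
      "\<And>n k x h. x \<in> space X \<Longrightarrow> meager ({g. g - h \<in> B k} - return_set act (E n) x) \<Longrightarrow> \<exists>h. act h x \<in> C n k"
    unfolding sel_def by blast+
  \<comment> \<open>Separation is lost in unions, but a finite union still meets every compact piece
    of an orbit in a finite set.\<close>
  define Cm where "Cm m = (\<Union>n\<le>m. \<Union>k\<le>m. C n k)" for m
  define CC where "CC = (\<Union>m. Cm m)"
  have Cm: "Cm m \<in> sets X" for m
    unfolding Cm_def using C(1) by (intro sets.finite_UN) auto
  have CC: "CC \<in> sets X" unfolding CC_def using Cm by (intro sets.countable_UN) auto
  have Cm_mono: "Cm m \<subseteq> Cm m'" if "m \<le> m'" for m m'
    unfolding Cm_def using that by (intro UN_mono) auto
  have CCX: "CC \<subseteq> space X" using CC by (rule sets.sets_into_space)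
  have fin: "finite ({g. act g x \<in> Cm m} \<inter> L)" if x: "x \<in> space X" and L: "compact L" for x m L
  proof -
    have "finite ({g. act g x \<in> C n k} \<inter> L)" for n k
    proof (rule finite_Int_compact_if_separated[OF B[of k] _ L])
      fix g g' assume g: "g \<in> {g. act g x \<in> C n k}" "g' \<in> {g. act g x \<in> C n k}" "g' - g \<in> B k"
      have "act (g' - g) (act g x) = act g' x" using x by (simp add: act_act)
      then have "g' - g = 0" using C(2)[of "act g x" n k "g' - g"] g by simp
      then show "g' = g" by simp
    qed
    then have "finite (\<Union>n\<le>m. \<Union>k\<le>m. {g. act g x \<in> C n k} \<inter> L)" by blast
    then show ?thesis by (rule finite_subset[rotated]) (auto simp: Cm_def)
  qed
  have meets: "\<exists>h. act h x \<in> CC" if x: "x \<in> space X" for x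
  proof -
    have "(\<Union>n. return_set act (E n) x) = UNIV"
    proof -
      have "(x, act g x) \<in> (\<Union>n. E n)" for g
        unfolding E(3)[symmetric] orbit_rel_iff using x by blast
      then show ?thesis unfolding return_set_def by blast
    qed
    then have "\<exists>n. \<not> meager (return_set act (E n) x)"
      using meager_UN[of "\<lambda>n. return_set act (E n) x"] open_not_meager[OF open_UNIV, where 'a = 'g] by auto
    then obtain n where nm: "\<not> meager (UNIV \<inter> return_set act (E n) x)" by auto
    have "return_set act (E n) x \<in> sets borel"
    proof -
      have [measurable]: "Measurable.pred (X \<Otimes>\<^sub>M X) (\<lambda>p. p \<in> E n)" using Es by simp
      have "{g \<in> space borel. (x, act g x) \<in> E n} \<in> sets borel" using x by measurable
      then show ?thesis unfolding return_set_def by simp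
    qed
    then obtain j where j: "basic_open j \<noteq> ({} :: 'g set)" "meager (basic_open j - return_set act (E n) x)"
      using nonmeager_borel_localization[OF _ open_UNIV nm] by blast
    obtain h :: 'g where h: "h \<in> basic_open j" using j(1) by blast
    \<comment> \<open>The basic open set in which the class is comeager is translated to a
      neighbourhood of \<open>0\<close>, which then contains some \<open>B k\<close>; so
      \<open>h\<close> is a centre for the scale \<open>k\<close>.\<close>
    have "open ((\<lambda>b. b + h) -` basic_open j)"
      by (intro open_vimage continuous_intros open_basic_open)
    moreover have "0 \<in> (\<lambda>b. b + h) -` basic_open j" using h by simp
    ultimately obtain e where e: "e > 0" "ball 0 e \<subseteq> (\<lambda>b. b + h) -` basic_open j"
      using open_contains_ball by metis
    obtain k where k: "1 / real (Suc k) < e" using nat_approx_posE[OF e(1)] by blast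
    have "{g. g - h \<in> B k} \<subseteq> basic_open j"
    proof clarify
      fix g assume "g - h \<in> B k"
      then have "g - h \<in> ball 0 e" using k unfolding B_def by auto
      then have "g - h + h \<in> basic_open j" using e(2) by blast
      then show "g \<in> basic_open j" by simp
    qed
    then have "meager ({g. g - h \<in> B k} - return_set act (E n) x)"
      using j(2) by (elim meager_subset) blast
    then obtain h' where h': "act h' x \<in> C n k" using C(3)[OF x] by blast
    have "C n k \<subseteq> Cm (max n k)" unfolding Cm_def by fastforce
    then show ?thesis using h' unfolding CC_def by blast
  qed
  have count: "countable (range (\<lambda>g. act g x) \<inter> CC)" if x: "x \<in> space X" for x
  proof -
    have "range (\<lambda>g. act g x) \<inter> CC \<subseteq> (\<Union>m. \<Union>j. (\<lambda>g. act g x) ` ({g. act g x \<in> Cm m} \<inter> K j))"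
    proof
      fix y assume "y \<in> range (\<lambda>g. act g x) \<inter> CC"
      then obtain g m where g: "y = act g x" "y \<in> Cm m" unfolding CC_def by blast
      obtain j where "g \<in> K j" using K(3) by blast
      then have "y \<in> (\<lambda>g. act g x) ` ({g. act g x \<in> Cm m} \<inter> K j)" using g by blast
      then show "y \<in> (\<Union>m. \<Union>j. (\<lambda>g. act g x) ` ({g. act g x \<in> Cm m} \<inter> K j))" by blast
    qed
    moreover have "countable (\<Union>m. \<Union>j. (\<lambda>g. act g x) ` ({g. act g x \<in> Cm m} \<inter> K j))"
      by (intro countable_UN[OF countableI_type] countable_image countable_finite fin[OF x K(1)])
    ultimately show ?thesis by (rule countable_subset)
  qed
  have cs: "cross_section X act CC"
    unfolding cross_section_def using CC meets count by blast
  let ?Y = "restrict_space X CC"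
  let ?R = "orbit_rel X act \<inter> (CC \<times> CC)"
  have spY: "space ?Y = CC" using CC by simp
  have restr: "A \<inter> (CC \<times> CC) \<in> sets (?Y \<Otimes>\<^sub>M ?Y)" if A: "A \<in> sets (X \<Otimes>\<^sub>M X)" for A
  proof -
    have "(\<lambda>p. (fst p, snd p)) \<in> ?Y \<Otimes>\<^sub>M ?Y \<rightarrow>\<^sub>M X \<Otimes>\<^sub>M X"
      by (intro measurable_Pair measurable_compose[OF measurable_fst] measurable_compose[OF measurable_snd]
          measurable_restrict_space1 measurable_ident_sets refl)
    from measurable_sets[OF this A] show ?thesis
      by (simp add: space_pair_measure spY)
  qed
  \<comment> \<open>An \<open>E m\<close>-class may meet all of \<open>CC\<close> in an infinite
    set, so only the points of \<open>Cm m\<close> are related at stage \<open>m\<close>; the others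
    form singleton classes until \<open>Cm\<close> reaches them.\<close>
  define F where "F m = ((E m \<inter> (Cm m \<times> Cm m)) \<union> {p \<in> space (X \<Otimes>\<^sub>M X). fst p = snd p}) \<inter> (CC \<times> CC)" for m
  have Cm_CC: "Cm m \<subseteq> CC" for m unfolding CC_def by blast
  have Fmem: "(x, y) \<in> F m \<longleftrightarrow> x \<in> CC \<and> y \<in> CC \<and> (x = y \<or> (x, y) \<in> E m \<and> x \<in> Cm m \<and> y \<in> Cm m)" for x y m
    unfolding F_def using CCX by (auto simp: space_pair_measure)
  have F_equiv: "equiv CC (F m)" for m
  proof (rule equivI)
    show "F m \<subseteq> CC \<times> CC" "refl_on CC (F m)"
      unfolding refl_on_def using Fmem by auto
    show "sym (F m)"
      using Fmem[of _ _ m] equivE[OF Eeq[of m]] unfolding sym_def by metis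
    show "trans (F m)"
      using Fmem[of _ _ m] equivE[OF Eeq[of m]] unfolding trans_def by metis
  qed
  have F_finite: "finite (F m `` {x})" if x: "x \<in> CC" for m x
  proof -
    have xX: "x \<in> space X" using x CCX by blast
    have "F m `` {x} \<subseteq> insert x ((\<lambda>g. act g x) ` ({g. act g x \<in> Cm m} \<inter> closure (return_set act (E m) x)))"
    proof
      fix y assume "y \<in> F m `` {x}"
      then have "x = y \<or> (x, y) \<in> E m \<and> y \<in> Cm m" using Fmem by blast
      moreover have "y \<in> (\<lambda>g. act g x) ` ({g. act g x \<in> Cm m} \<inter> closure (return_set act (E m) x))"
        if y: "(x, y) \<in> E m" "y \<in> Cm m"
      proof -
        have "(x, y) \<in> orbit_rel X act" using y(1) unfolding E(3) by blast
        then obtain g where g: "y = act g x" unfolding orbit_rel_iff by blast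
        then have "g \<in> return_set act (E m) x" using y(1) unfolding return_set_def by blast
        then show ?thesis using g y(2) closure_subset by blast
      qed
      ultimately show "y \<in> insert x ((\<lambda>g. act g x) ` ({g. act g x \<in> Cm m} \<inter> closure (return_set act (E m) x)))"
        by blast
    qed
    then show ?thesis using fin[OF xX Ec[OF xX]] by (meson finite_imageI finite_insert finite_subset)
  qed
  have R_UN: "?R = (\<Union>m. F m)"
  proof (intro equalityI subrelI)
    fix x y assume xy: "(x, y) \<in> ?R"
    then obtain n where n: "(x, y) \<in> E n" using E(3) by blast
    obtain m1 where m1: "x \<in> Cm m1" using xy unfolding CC_def by blast
    obtain m2 where m2: "y \<in> Cm m2" using xy unfolding CC_def by blast
    define m where "m = max n (max m1 m2)"
    have "E n \<subseteq> E m" "Cm m1 \<subseteq> Cm m" "Cm m2 \<subseteq> Cm m"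
      using E(1) Cm_mono unfolding incseq_def m_def by auto
    then have "(x, y) \<in> F m" using n m1 m2 xy unfolding Fmem by blast
    then show "(x, y) \<in> (\<Union>m. F m)" by blast
  next
    fix x y assume "(x, y) \<in> (\<Union>m. F m)"
    then obtain m where "x \<in> CC" "y \<in> CC" "x = y \<or> (x, y) \<in> E m" using Fmem by blast
    moreover have "(x, x) \<in> orbit_rel X act" if "x \<in> CC"
      unfolding orbit_rel_iff using that CCX by (intro conjI exI[of _ 0]) auto
    ultimately show "(x, y) \<in> ?R" unfolding E(3) by blast
  qed
  have inc: "incseq F"
  proof (rule incseq_SucI, rule subrelI)
    fix m x y assume "(x, y) \<in> F m"
    then show "(x, y) \<in> F (Suc m)"
      using incseq_SucD[OF E(1), of m] Cm_mono[of m "Suc m"] unfolding Fmem by auto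
  qed
  have "hyperfinite ?Y ?R"
    unfolding hyperfinite_def borel_equiv_rel_def spY
  proof (intro conjI ballI exI[of _ F] allI)
    show "?R \<in> sets (?Y \<Otimes>\<^sub>M ?Y)"
      unfolding E(3) by (intro restr sets.countable_UN) (use Es in auto)
    show "equiv CC ?R"
    proof (rule equivI)
      show "?R \<subseteq> CC \<times> CC" by blast
      show "refl_on CC ?R"
        unfolding R_UN refl_on_def using Fmem by blast
      show "sym ?R"
        unfolding R_UN sym_def using F_equiv by (meson UN_iff equivE symD)
      show "trans ?R"
      proof (rule transI)
        fix x y z assume "(x, y) \<in> ?R" "(y, z) \<in> ?R"
        then show "(x, z) \<in> ?R" unfolding orbit_rel_def by (auto simp: act_act)
      qed
    qed
    show "countable (?R `` {x})" if "x \<in> CC" for x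
      unfolding R_UN using F_finite[OF that] by (simp add: UN_Image countable_finite)
    show "F m \<in> sets (?Y \<Otimes>\<^sub>M ?Y)" for m
      unfolding F_def using Es Cm standard_borel_sets_diagonal[OF sbs] by (intro restr sets.Un sets.Int) auto
  qed (use inc F_equiv F_finite R_UN in auto)
  then show ?thesis unfolding sectional_hyperfinite_def using cs by blast
qed

end

theorem theorem1p1:
  fixes X :: "'x measure"
    and act :: "'g::{topological_group_add, polish_space} \<Rightarrow> 'x \<Rightarrow> 'x"
  assumes "locally_compact_space (euclidean :: 'g topology)"
    and "borel_G_space X act"
    and "free_action X act"
  shows "sectional_hyperfinite X act \<longleftrightarrow> hypercompact X act"
proof -
  interpret free_borel_action X act by unfold_locales fact+
  show ?thesis
    using sectional_hyperfinite_imp_hypercompact hypercompact_imp_sectional_hyperfinite by blast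
qed

end
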